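(* Let $G$ be a compact connected semisimple Lie group with complexification $G_{\mathbb C}$ and let $P\subset G_{\mathbb C}$ be a parabolic subgroup. For each $\beta\in S\setminus S_P$ and each $j=1,\ldots,n_\beta-1$, the Hilbert polynomial $\mathrm H_P\Big(\sum_{\gamma\in S\setminus S_P}k_\gamma\varpi_\gamma\Big)$, viewed as a polynomial in the variables $k_\gamma$ ($\gamma\in S\setminus S_P$), vanishes at $k_\beta=-j$ (that is, it becomes identically zero after substituting $k_\beta=-j$).
   Context: Fix a maximal torus $T\subset G$ and a Borel subgroup $B$ with $T_{\mathbb C}\subset B\subset P$. $R$ is the set of roots, $R^+$ the positive roots compatible with $B$, $S\subset R^+$ the simple roots. $S_P\subset S$ is the set of simple roots whose reflections lie in the Weyl group $W_P=N_P(T)/T$ of $P$, and $R_P^+$ is the set of positive roots generated by $S_P$. For a root $\alpha$, $\alpha^\vee=\check\alpha=2\alpha/(\alpha,\alpha)$ is its coroot with respect to an invariant inner product, and $\{\varpi_\alpha\}_{\alpha\in S}$ is the basis of fundamental weights, dual to the simple coroots. For $\beta\in S$, $n_\beta:=\sum_{\alpha\in R^+\setminus R_P^+}\langle\alpha,\beta^\vee\rangle$; thus $c_1(T(G_{\mathbb C}/P))=\sum_{\beta\in S\setminus S_P}n_\beta\varpi_\beta$ under the identification below. For $\varpi\in\mathbb Z\{\varpi_\alpha\mid\alpha\in S\setminus S_P\}$, $\mathbb L_\varpi=G_{\mathbb C}\times^P\mathbb C(\varpi)$ is the homogeneous holomorphic line bundle on $G_{\mathbb C}/P$ associated with $\varpi$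 (if $G$ is not simply connected, it is formed using the simply connected cover of $G_{\mathbb C}$, which has the same flag variety), with the sign convention that for dominant $\varpi$ the space $H^0(\mathbb L_\varpi)$ is the irreducible representation of highest weight $\varpi$. The map $\varpi\mapsto c_1(\mathbb L_\varpi)$ identifies $\mathbb Z\{\varpi_\alpha\mid\alpha\in S\setminus S_P\}$ with $H^2(G_{\mathbb C}/P;\mathbb Z)$. The Hilbert polynomial $\mathrm H_P$ of $G_{\mathbb C}/P$ is the polynomial in the $k_\gamma$'s given at integral points by the index $\mathrm H_P(\varpi)=\operatorname{Ind}(\mathbb L_\varpi)$, $\varpi=\sum_{\gamma\in S\setminus S_P}k_\gamma\varpi_\gamma$. By the Bott-Borel-Weil theorem and the Weyl dimension formula, $\mathrm H_P(\varpi)=\prod_{\alpha\in R^+\setminus R_P^+}\frac{\langle\varpi+\rho,\alpha^\vee\rangle}{\langle\rho,\alpha^\vee\rangle}$ with $\rho=\frac12\sum_{\alpha\in R^+}\alpha$. *)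

theory Defs
  imports "HOL-Analysis.Analysis" "HOL-Library.Poly_Mapping"
begin

section \<open>Root data of a compact semisimple group and a parabolic subgroup\<close>

text \<open>
  A compact connected semisimple group \<open>G\<close> enters through its root system \<open>R\<close>, which lives in the
  real span of the weights (the ambient Euclidean space, with an invariant inner product; it is
  spanned by \<open>R\<close> because \<open>G\<close> is semisimple).  A Borel subgroup \<open>B\<close> containing the complexified
  torus enters through its set \<open>Rp\<close> of positive roots, and a parabolic subgroup \<open>P\<close> containing
  \<open>B\<close> through the set \<open>Q\<close> of roots of its Lie algebra.
\<close>

definition coroot :: "'a::real_inner \<Rightarrow> 'a" where
  "coroot \<alpha> = (2 / (\<alpha> \<bullet> \<alpha>)) *\<^sub>R \<alpha>"

definition root_reflection :: "'a::real_inner \<Rightarrow> 'a \<Rightarrow> 'a" where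
  "root_reflection \<alpha> v = v - (v \<bullet> coroot \<alpha>) *\<^sub>R \<alpha>"

definition root_system :: "'a::euclidean_space set \<Rightarrow> bool" where
  "root_system R \<longleftrightarrow>
     finite R \<and> 0 \<notin> R \<and> span R = UNIV \<and>
     (\<forall>\<alpha>\<in>R. root_reflection \<alpha> ` R = R) \<and>
     (\<forall>\<alpha>\<in>R. \<forall>\<beta>\<in>R. \<alpha> \<bullet> coroot \<beta> \<in> \<int>) \<and>
     (\<forall>\<alpha>\<in>R. \<forall>c. c *\<^sub>R \<alpha> \<in> R \<longrightarrow> c = 1 \<or> c = - 1)"

definition positive_system :: "'a::euclidean_space set \<Rightarrow> 'a set \<Rightarrow> bool" where
  "positive_system R Rp \<longleftrightarrow>
     (\<exists>\<xi>. (\<forall>\<alpha>\<in>R. \<xi> \<bullet> \<alpha> \<noteq> 0) \<and> Rp = {\<alpha>\<in>R. \<xi> \<bullet> \<alpha> > 0})"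

definition simple_roots :: "'a::euclidean_space set \<Rightarrow> 'a set" where
  "simple_roots Rp = {\<alpha>\<in>Rp. \<not> (\<exists>\<beta>\<in>Rp. \<exists>\<gamma>\<in>Rp. \<alpha> = \<beta> + \<gamma>)}"

text \<open>The sets of roots of the parabolic subalgebras containing the Borel subalgebra of \<open>Rp\<close>.\<close>

definition parabolic_roots :: "'a::euclidean_space set \<Rightarrow> 'a set \<Rightarrow> 'a set \<Rightarrow> bool" where
  "parabolic_roots R Rp Q \<longleftrightarrow>
     Rp \<subseteq> Q \<and> Q \<subseteq> R \<and> (\<forall>\<alpha>\<in>Q. \<forall>\<beta>\<in>Q. \<alpha> + \<beta> \<in> R \<longrightarrow> \<alpha> + \<beta> \<in> Q)"

inductive_set reflection_group :: "'a::euclidean_space set \<Rightarrow> ('a \<Rightarrow> 'a) set"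
  for A :: "'a set" where
  id: "id \<in> reflection_group A"
| step: "w \<in> reflection_group A \<Longrightarrow> \<alpha> \<in> A \<Longrightarrow> root_reflection \<alpha> \<circ> w \<in> reflection_group A"

abbreviation weyl_group :: "'a::euclidean_space set \<Rightarrow> ('a \<Rightarrow> 'a) set" where
  "weyl_group R \<equiv> reflection_group R"

text \<open>\<open>W\<^sub>P\<close> is the Weyl group of the Levi factor of \<open>P\<close>, whose roots are those \<open>\<alpha>\<close> with both
  \<open>\<alpha>\<close> and \<open>-\<alpha>\<close> in \<open>Q\<close>.\<close>

definition parabolic_weyl_group :: "'a::euclidean_space set \<Rightarrow> ('a \<Rightarrow> 'a) set" where
  "parabolic_weyl_group Q = reflection_group (Q \<inter> uminus ` Q)"

definition parabolic_simple_roots :: "'a::euclidean_space set \<Rightarrow> 'a set \<Rightarrow> 'a set" where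
  "parabolic_simple_roots Rp Q =
     {\<alpha>\<in>simple_roots Rp. root_reflection \<alpha> \<in> parabolic_weyl_group Q}"

definition parabolic_positive_roots :: "'a::euclidean_space set \<Rightarrow> 'a set \<Rightarrow> 'a set" where
  "parabolic_positive_roots Rp Q =
     {\<alpha>\<in>Rp. \<exists>c :: 'a \<Rightarrow> nat. \<alpha> = (\<Sum>\<gamma>\<in>parabolic_simple_roots Rp Q. of_nat (c \<gamma>) *\<^sub>R \<gamma>)}"

definition rho :: "'a::euclidean_space set \<Rightarrow> 'a" where
  "rho Rp = (1 / 2) *\<^sub>R (\<Sum>\<alpha>\<in>Rp. \<alpha>)"

definition fundamental_weight :: "'a::euclidean_space set \<Rightarrow> 'a \<Rightarrow> 'a" where
  "fundamental_weight Rp \<alpha> =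
     (THE v. \<forall>\<gamma>\<in>simple_roots Rp. v \<bullet> coroot \<gamma> = (if \<gamma> = \<alpha> then 1 else 0))"

text \<open>The coefficient \<open>n\<^sub>\<beta>\<close> of the first Chern class of the flag variety.\<close>

definition chern_coeff :: "'a::euclidean_space set \<Rightarrow> 'a set \<Rightarrow> 'a \<Rightarrow> real" where
  "chern_coeff Rp Q \<beta> = (\<Sum>\<alpha>\<in>Rp - parabolic_positive_roots Rp Q. \<alpha> \<bullet> coroot \<beta>)"


section \<open>The index of a homogeneous line bundle\<close>

definition dominant :: "'a::euclidean_space set \<Rightarrow> 'a \<Rightarrow> bool" where
  "dominant Rp v \<longleftrightarrow> (\<forall>\<gamma>\<in>simple_roots Rp. v \<bullet> coroot \<gamma> \<ge> 0)"

definition weyl_length :: "'a::euclidean_space set \<Rightarrow> ('a \<Rightarrow> 'a) \<Rightarrow> nat" where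
  "weyl_length Rp w = card {\<alpha>\<in>Rp. w \<alpha> \<notin> Rp}"

text \<open>The dimension of the irreducible representation of highest weight \<open>v\<close>, for \<open>v\<close> dominant and
  integral, as given by Weyl's dimension formula.\<close>

definition irrep_dim :: "'a::euclidean_space set \<Rightarrow> 'a \<Rightarrow> real" where
  "irrep_dim Rp v = (\<Prod>\<alpha>\<in>Rp. ((v + rho Rp) \<bullet> coroot \<alpha>) / (rho Rp \<bullet> coroot \<alpha>))"

text \<open>The highest weights of the irreducible constituents of \<open>H\<^sup>i(\<L>\<^sub>v)\<close>, as given by the
  Bott-Borel-Weil theorem: \<open>H\<^sup>i(\<L>\<^sub>v)\<close> is irreducible of highest weight \<open>w(v + \<rho>) - \<rho>\<close> if this is
  dominant for some \<open>w\<close> of length \<open>i\<close> (this set is then a singleton), and zero otherwise.  For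
  \<open>i = 0\<close> and \<open>v\<close> dominant this is the convention that \<open>H\<^sup>0(\<L>\<^sub>v)\<close> has highest weight \<open>v\<close>.
  The weight \<open>v\<close> is meant to be an integral combination of the fundamental weights
  attached to \<open>S - S\<^sub>P\<close>.\<close>

definition cohomology_weights ::
  "'a::euclidean_space set \<Rightarrow> 'a set \<Rightarrow> 'a \<Rightarrow> nat \<Rightarrow> 'a set" where
  "cohomology_weights R Rp v i =
     {\<mu>. dominant Rp \<mu> \<and>
         (\<exists>w\<in>weyl_group R. weyl_length Rp w = i \<and> \<mu> = w (v + rho Rp) - rho Rp)}"

definition cohomology_dim :: "'a::euclidean_space set \<Rightarrow> 'a set \<Rightarrow> 'a \<Rightarrow> nat \<Rightarrow> real" where
  "cohomology_dim R Rp v i = (\<Sum>\<mu>\<in>cohomology_weights R Rp v i. irrep_dim Rp \<mu>)"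

text \<open>The index is the holomorphic Euler characteristic; the range of summation ends with the
  complex dimension of the flag variety.\<close>

definition line_bundle_index :: "'a::euclidean_space set \<Rightarrow> 'a set \<Rightarrow> 'a set \<Rightarrow> 'a \<Rightarrow> real" where
  "line_bundle_index R Rp Q v =
     (\<Sum>i\<le>card (Rp - parabolic_positive_roots Rp Q). (- 1) ^ i * cohomology_dim R Rp v i)"


section \<open>Polynomials in several variables and the Hilbert polynomial\<close>

text \<open>A polynomial maps monomials (finitely supported exponent functions) to coefficients.\<close>

type_synonym 'v mpoly = "('v \<Rightarrow>\<^sub>0 nat) \<Rightarrow>\<^sub>0 real"

definition mpoly_vars :: "'v mpoly \<Rightarrow> 'v set" where
  "mpoly_vars p = (\<Union>m\<in>Poly_Mapping.keys p. Poly_Mapping.keys m)"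

definition mpoly_eval :: "('v \<Rightarrow> real) \<Rightarrow> 'v mpoly \<Rightarrow> real" where
  "mpoly_eval k p =
     (\<Sum>m\<in>Poly_Mapping.keys p. Poly_Mapping.lookup p m *
        (\<Prod>v\<in>Poly_Mapping.keys m. k v ^ Poly_Mapping.lookup m v))"

text \<open>Substitution of the constant \<open>c\<close> for the single variable \<open>v\<close>; the result is a polynomial in
  the remaining variables.\<close>

definition mpoly_subst :: "'v \<Rightarrow> real \<Rightarrow> 'v mpoly \<Rightarrow> 'v mpoly" where
  "mpoly_subst v c p =
     (\<Sum>m\<in>Poly_Mapping.keys p.
        Poly_Mapping.single (Poly_Mapping.update v 0 m)
          (Poly_Mapping.lookup p m * c ^ Poly_Mapping.lookup m v))"

text \<open>The variable \<open>k\<^sub>\<gamma>\<close> is named by the simple root \<open>\<gamma>\<close> itself.\<close>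

definition hilbert_polynomial ::
  "'a::euclidean_space set \<Rightarrow> 'a set \<Rightarrow> 'a set \<Rightarrow> 'a mpoly" where
  "hilbert_polynomial R Rp Q =
     (THE p. mpoly_vars p \<subseteq> simple_roots Rp - parabolic_simple_roots Rp Q \<and>
        (\<forall>k :: 'a \<Rightarrow> int.
           mpoly_eval (\<lambda>\<gamma>. of_int (k \<gamma>)) p =
           line_bundle_index R Rp Q
             (\<Sum>\<gamma>\<in>simple_roots Rp - parabolic_simple_roots Rp Q.
                of_int (k \<gamma>) *\<^sub>R fundamental_weight Rp \<gamma>)))"

end

theory Submission
  imports Defs
begin

text \<open>
  The Hilbert polynomial factors into linear forms, and the claim holds because for each \<open>j\<close> one of
  these forms is a nonzero multiple of \<open>k\<^sub>\<beta> + j\<close> alone.  Write \<open>S\<close> for the simple roots, \<open>I\<close> for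
  \<open>S\<^sub>P\<close>, and call \<open>\<langle>\<rho>, \<alpha>\<^sup>\<or>\<rangle>\<close> the height of the coroot \<open>\<alpha>\<^sup>\<or>\<close>.

  \<^bold>\<open>Factorisation.\<close>  The index is an alternating sum over cohomology groups, but for each weight \<open>v\<close>
  at most one group is nonzero, and its degree \<open>n\<close> is the number of positive roots on which \<open>v + \<rho>\<close>
  is negative.  Reflecting \<open>v + \<rho>\<close> in simple roots makes it dominant; each step changes the sign of
  Weyl's product and lowers the number of negative roots by one (\<open>move_to_dominant\<close>).  The resulting
  sign \<open>(-1)\<^sup>n\<close> cancels the one in the alternating sum.  That only one representation contributes is
  the uniqueness of the strictly dominant point of an orbit (\<open>strictly_dominant_orbit_unique\<close>), which
  rests on the exchange property of words in simple reflections.  So the index is Weyl's product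
  \<open>\<Prod>\<^bsub>\<alpha>>0\<^esub> \<langle>v + \<rho>, \<alpha>\<^sup>\<or>\<rangle> / \<langle>\<rho>, \<alpha>\<^sup>\<or>\<rangle>\<close> (\<open>line_bundle_index_eq_weyl_dim\<close>).  This is polynomial in the
  coordinates of \<open>v\<close>, and a polynomial is determined by its values at integer points
  (\<open>mpoly_eqI\<close>), so it is the Hilbert polynomial.

  \<^bold>\<open>Vanishing.\<close>  Suppose that a coroot \<open>\<alpha>\<^sup>\<or>\<close> of height \<open>j\<close> is congruent to \<open>\<beta>\<^sup>\<or>\<close> modulo the span of
  \<open>I\<close>.  As \<open>v\<close> is orthogonal to \<open>I\<close>, we get \<open>\<langle>v + \<rho>, \<alpha>\<^sup>\<or>\<rangle> = k\<^sub>\<beta> + j\<close>, which vanishes at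
  \<open>k\<^sub>\<beta> = -j\<close> whatever the other variables are.  Such coroots exist for every \<open>j\<close> from \<open>1\<close> to
  \<open>n\<^sub>\<beta> - 1\<close>: if \<open>w\<close> is the longest element of the group generated by the reflections in \<open>I\<close>, then
  \<open>w \<beta>\<^sup>\<or>\<close> has height \<open>n\<^sub>\<beta> - 1\<close> (\<open>coroot_of_height_chern_coeff\<close>), while \<open>\<beta>\<^sup>\<or>\<close> has height \<open>1\<close>.  Each
  reflection on the way from \<open>\<beta>\<^sup>\<or>\<close> to \<open>w \<beta>\<^sup>\<or>\<close> moves along an unbroken root string in the direction of
  a simple coroot, which has height \<open>1\<close>, so no height is skipped
  (\<open>coroots_of_all_smaller_heights\<close>).
\<close>

section \<open>Polynomials and their values at integer points\<close>

definition monom_eval :: "('v \<Rightarrow> real) \<Rightarrow> ('v \<Rightarrow>\<^sub>0 nat) \<Rightarrow> real" where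
  "monom_eval k m = (\<Prod>v\<in>Poly_Mapping.keys m. k v ^ Poly_Mapping.lookup m v)"

lemma monom_eval_superset:
  assumes "finite V" "Poly_Mapping.keys m \<subseteq> V"
  shows "monom_eval k m = (\<Prod>v\<in>V. k v ^ Poly_Mapping.lookup m v)"
  unfolding monom_eval_def using assms
  by (intro prod.mono_neutral_left) (auto simp: in_keys_iff)

lemma mpoly_eval_superset:
  assumes "finite A" "Poly_Mapping.keys p \<subseteq> A"
  shows "mpoly_eval k p = (\<Sum>m\<in>A. Poly_Mapping.lookup p m * monom_eval k m)"
  unfolding mpoly_eval_def monom_eval_def using assms
  by (intro sum.mono_neutral_left) (auto simp: in_keys_iff)

lemma mpoly_eval_keys:
  "mpoly_eval k p = (\<Sum>m\<in>Poly_Mapping.keys p. Poly_Mapping.lookup p m * monom_eval k m)"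
  by (simp add: mpoly_eval_def monom_eval_def)

lemma mpoly_eval_0 [simp]: "mpoly_eval k 0 = 0"
  by (simp add: mpoly_eval_def)

lemma mpoly_eval_add: "mpoly_eval k (p + q) = mpoly_eval k p + mpoly_eval k q"
proof -
  let ?A = "Poly_Mapping.keys p \<union> Poly_Mapping.keys q"
  have "Poly_Mapping.keys (p + q) \<subseteq> ?A" by (rule Poly_Mapping.keys_add)
  then show ?thesis
    by (simp add: mpoly_eval_superset[of ?A] lookup_add distrib_right sum.distrib)
qed

lemma mpoly_eval_sum: "mpoly_eval k (\<Sum>i\<in>A. p i) = (\<Sum>i\<in>A. mpoly_eval k (p i))"
  by (induction A rule: infinite_finite_induct) (auto simp: mpoly_eval_add)

lemma mpoly_eval_single: "mpoly_eval k (Poly_Mapping.single m a) = a * monom_eval k m"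
  by (subst mpoly_eval_superset[of "{m}"]) auto

lemma monom_eval_add: "monom_eval k (m + n) = monom_eval k m * monom_eval k n"
proof -
  let ?V = "Poly_Mapping.keys m \<union> Poly_Mapping.keys n"
  have "Poly_Mapping.keys (m + n) \<subseteq> ?V" by (rule Poly_Mapping.keys_add)
  then show ?thesis
    by (simp add: monom_eval_superset[of ?V] lookup_add power_add prod.distrib)
qed

lemma mpoly_eq_sum_single:
  fixes p :: "'v mpoly"
  shows "p = (\<Sum>m\<in>Poly_Mapping.keys p. Poly_Mapping.single m (Poly_Mapping.lookup p m))"
  by (rule poly_mapping_eqI)
     (auto simp: lookup_sum lookup_single when_def in_keys_iff)

lemma mpoly_eval_mult: "mpoly_eval k (p * q) = mpoly_eval k p * mpoly_eval k q"
proof -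
  have "p * q = (\<Sum>m\<in>Poly_Mapping.keys p. \<Sum>n\<in>Poly_Mapping.keys q.
      Poly_Mapping.single (m + n) (Poly_Mapping.lookup p m * Poly_Mapping.lookup q n))"
    by (subst mpoly_eq_sum_single[of p], subst mpoly_eq_sum_single[of q])
       (simp add: sum_product mult_single)
  then have "mpoly_eval k (p * q) = (\<Sum>m\<in>Poly_Mapping.keys p. \<Sum>n\<in>Poly_Mapping.keys q.
      (Poly_Mapping.lookup p m * Poly_Mapping.lookup q n) * (monom_eval k m * monom_eval k n))"
    by (simp add: mpoly_eval_sum mpoly_eval_single monom_eval_add)
  then show ?thesis
    by (simp add: mpoly_eval_keys[of k p] mpoly_eval_keys[of k q] sum_product ac_simps)
qed

lemma mpoly_eval_subst: "mpoly_eval k (mpoly_subst v c p) = mpoly_eval (k(v := c)) p"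
proof -
  have "monom_eval (k(v := c)) m
      = c ^ Poly_Mapping.lookup m v * monom_eval k (Poly_Mapping.update v 0 m)" for m
  proof -
    let ?V = "insert v (Poly_Mapping.keys m)"
    have "Poly_Mapping.keys (Poly_Mapping.update v 0 m) \<subseteq> ?V"
      by (auto simp: keys_update)
    then show ?thesis
      by (subst (1 2) monom_eval_superset[of ?V])
         (auto simp: prod.insert_remove lookup_update intro!: prod.cong)
  qed
  then show ?thesis
    by (simp add: mpoly_subst_def mpoly_eval_sum mpoly_eval_single
        mpoly_eval_keys[of "k(v := c)"] mult.assoc)
qed

text \<open>
  Induction on the set of variables: for fixed values of the others, the sum is a polynomial in one
  variable with infinitely many roots, so each of its coefficients vanishes, and these are sums of
  the same kind.  Distinctness is asked of the exponents restricted to \<open>V\<close>, so that the monomials with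
  a given exponent at one variable can be passed to the induction hypothesis as they are.
\<close>

lemma monomials_independent_on_integers:
  fixes a :: "'m \<Rightarrow> real" and e :: "'m \<Rightarrow> 'v \<Rightarrow> nat"
  assumes "finite V" "finite A" "inj_on (\<lambda>m. restrict (e m) V) A"
    and "\<And>k :: 'v \<Rightarrow> int. (\<Sum>m\<in>A. a m * (\<Prod>v\<in>V. of_int (k v) ^ e m v)) = 0"
  shows "\<forall>m\<in>A. a m = 0"
  using assms
proof (induction V arbitrary: A rule: finite_induct)
  case empty
  have eq: "m = n" if "m \<in> A" "n \<in> A" for m n
    using empty.prems(2) that by (auto simp: inj_on_def)
  show ?case
  proof
    fix m assume m: "m \<in> A"
    then have "A = {m}" using eq by blast
    then show "a m = 0" using empty.prems(3) by simp
  qed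
next
  case (insert v V)
  define d where "d = (\<Sum>m\<in>A. e m v)"
  have d: "e m v \<le> d" if "m \<in> A" for m
    using that insert.prems(1) unfolding d_def by (intro member_le_sum) auto
  have zero: "\<forall>m\<in>{m\<in>A. e m v = i}. a m = 0" if i: "i \<le> d" for i
  proof (rule insert.IH)
    show "finite {m \<in> A. e m v = i}" using insert.prems(1) by simp
    show "inj_on (\<lambda>m. restrict (e m) V) {m \<in> A. e m v = i}"
    proof (rule inj_onI)
      fix m n assume mn: "m \<in> {m \<in> A. e m v = i}" "n \<in> {m \<in> A. e m v = i}"
        and eq: "restrict (e m) V = restrict (e n) V"
      have "restrict (e m) (insert v V) = restrict (e n) (insert v V)"
        using mn fun_cong[OF eq] by (simp add: restrict_def fun_eq_iff) metis
      then show "m = n" using mn inj_onD[OF insert.prems(2)] by blast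
    qed
    fix k :: "'v \<Rightarrow> int"
    define c :: "nat \<Rightarrow> real" where
      "c i = (\<Sum>m | m \<in> A \<and> e m v = i. a m * (\<Prod>v\<in>V. of_int (k v) ^ e m v))" for i
    have "(\<Sum>i\<le>d. c i * of_int t ^ i) = 0" for t :: int
    proof -
      let ?k = "k(v := t)"
      have "(\<Sum>i\<le>d. c i * of_int t ^ i) =
          (\<Sum>i\<le>d. \<Sum>m | m \<in> A \<and> e m v = i.
             a m * (\<Prod>u\<in>insert v V. of_int (?k u) ^ e m u))"
        unfolding c_def sum_distrib_right
      proof (intro sum.cong refl)
        fix i m assume "m \<in> {m \<in> A. e m v = i}"
        moreover have "(\<Prod>u\<in>V. of_int (?k u) ^ e m u) = (\<Prod>u\<in>V. (of_int (k u) :: real) ^ e m u)"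
          using insert.hyps by (intro prod.cong) auto
        ultimately show "a m * (\<Prod>v\<in>V. of_int (k v) ^ e m v) * of_int t ^ i =
            a m * (\<Prod>u\<in>insert v V. of_int (?k u) ^ e m u)"
          using insert.hyps by simp
      qed
      also have "\<dots> = (\<Sum>m\<in>A. a m * (\<Prod>u\<in>insert v V. of_int (?k u) ^ e m u))"
        using d insert.prems(1) by (intro sum.group) auto
      finally show ?thesis using insert.prems(3) by simp
    qed
    then have "range (of_int :: int \<Rightarrow> real) \<subseteq> {t. (\<Sum>i\<le>d. c i * t ^ i) = 0}"
      by auto
    moreover have "infinite (range (of_int :: int \<Rightarrow> real))"
      using finite_imageD[of "of_int :: int \<Rightarrow> real" UNIV] by (auto simp: inj_on_def)
    ultimately have "\<not> finite {t. (\<Sum>i\<le>d. c i * t ^ i) = 0}"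
      using finite_subset by blast
    then have "c i = 0" using i polyfun_finite_roots by blast
    then show "(\<Sum>m | m \<in> A \<and> e m v = i. a m * (\<Prod>v\<in>V. of_int (k v) ^ e m v)) = 0"
      by (simp add: c_def)
  qed
  show ?case using zero d by auto
qed

lemma mpoly_eqI:
  fixes p q :: "'v mpoly"
  assumes "\<And>k :: 'v \<Rightarrow> int. mpoly_eval (\<lambda>v. of_int (k v)) p = mpoly_eval (\<lambda>v. of_int (k v)) q"
  shows "p = q"
proof (rule poly_mapping_eqI)
  fix m
  define A where "A = Poly_Mapping.keys p \<union> Poly_Mapping.keys q"
  define V where "V = (\<Union>m\<in>A. Poly_Mapping.keys m)"
  have fin: "finite A" "finite V" by (auto simp: A_def V_def)
  have V: "Poly_Mapping.keys m \<subseteq> V" if "m \<in> A" for m using that by (auto simp: V_def)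
  have "\<forall>m\<in>A. Poly_Mapping.lookup p m - Poly_Mapping.lookup q m = 0"
  proof (rule monomials_independent_on_integers[OF fin(2,1), of Poly_Mapping.lookup])
    show "inj_on (\<lambda>m. restrict (Poly_Mapping.lookup m) V) A"
    proof (rule inj_onI, rule poly_mapping_eqI)
      fix m n v assume mn: "m \<in> A" "n \<in> A"
        and eq: "restrict (Poly_Mapping.lookup m) V = restrict (Poly_Mapping.lookup n) V"
      show "Poly_Mapping.lookup m v = Poly_Mapping.lookup n v"
        using fun_cong[OF eq, of v] V[OF mn(1)] V[OF mn(2)]
        by (cases "v \<in> V") (simp, metis in_keys_iff subset_iff)
    qed
    fix k :: "'v \<Rightarrow> int"
    let ?k = "\<lambda>v. of_int (k v) :: real"
    have "(\<Sum>m\<in>A. (Poly_Mapping.lookup p m - Poly_Mapping.lookup q m)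
            * (\<Prod>v\<in>V. ?k v ^ Poly_Mapping.lookup m v))
        = (\<Sum>m\<in>A. (Poly_Mapping.lookup p m - Poly_Mapping.lookup q m) * monom_eval ?k m)"
      using fin V by (intro sum.cong refl) (simp add: monom_eval_superset[of V])
    also have "\<dots> = mpoly_eval ?k p - mpoly_eval ?k q"
      using fin by (simp add: mpoly_eval_superset[of A] A_def left_diff_distrib sum_subtractf)
    finally show "(\<Sum>m\<in>A. (Poly_Mapping.lookup p m - Poly_Mapping.lookup q m)
            * (\<Prod>v\<in>V. ?k v ^ Poly_Mapping.lookup m v)) = 0"
      using assms by simp
  qed
  then have eq: "Poly_Mapping.lookup p m = Poly_Mapping.lookup q m" if "m \<in> A"
    using that by simp
  have "Poly_Mapping.lookup p m = 0" "Poly_Mapping.lookup q m = 0" if "m \<notin> A"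
    using that by (simp_all add: A_def in_keys_iff)
  with eq show "Poly_Mapping.lookup p m = Poly_Mapping.lookup q m" by metis
qed

text \<open>
  The set \<open>V\<close> of admissible variables is recorded because the Hilbert polynomial is singled out
  among the polynomials in the variables attached to \<open>S - S\<^sub>P\<close>.
\<close>

definition polynomial_function :: "'v set \<Rightarrow> (('v \<Rightarrow> real) \<Rightarrow> real) \<Rightarrow> bool" where
  "polynomial_function V f \<longleftrightarrow> (\<exists>p. mpoly_vars p \<subseteq> V \<and> (\<forall>k. mpoly_eval k p = f k))"

lemma polynomial_function_const: "polynomial_function V (\<lambda>k. c)"
  unfolding polynomial_function_def
  by (rule exI[of _ "Poly_Mapping.single 0 c"])
     (auto simp: mpoly_eval_single monom_eval_def mpoly_vars_def)

lemma polynomial_function_var: "v \<in> V \<Longrightarrow> polynomial_function V (\<lambda>k. k v)"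
  unfolding polynomial_function_def
  by (rule exI[of _ "Poly_Mapping.single (Poly_Mapping.single v 1) 1"])
     (auto simp: mpoly_eval_single monom_eval_def mpoly_vars_def)

lemma polynomial_function_add:
  assumes "polynomial_function V f" "polynomial_function V g"
  shows "polynomial_function V (\<lambda>k. f k + g k)"
proof -
  obtain p q where p: "mpoly_vars p \<subseteq> V" "\<And>k. mpoly_eval k p = f k"
    and q: "mpoly_vars q \<subseteq> V" "\<And>k. mpoly_eval k q = g k"
    using assms unfolding polynomial_function_def by blast
  have "mpoly_vars (p + q) \<subseteq> V"
    using p(1) q(1) Poly_Mapping.keys_add[of p q] unfolding mpoly_vars_def by blast
  then show ?thesis
    unfolding polynomial_function_def
    by (intro exI[of _ "p + q"]) (simp add: mpoly_eval_add p q)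
qed

lemma polynomial_function_mult:
  assumes "polynomial_function V f" "polynomial_function V g"
  shows "polynomial_function V (\<lambda>k. f k * g k)"
proof -
  obtain p q where p: "mpoly_vars p \<subseteq> V" "\<And>k. mpoly_eval k p = f k"
    and q: "mpoly_vars q \<subseteq> V" "\<And>k. mpoly_eval k q = g k"
    using assms unfolding polynomial_function_def by blast
  have "mpoly_vars (p * q) \<subseteq> V"
  proof -
    have "Poly_Mapping.keys m \<subseteq> V" if m: "m \<in> Poly_Mapping.keys (p * q)" for m
    proof -
      obtain a b where "m = a + b" "a \<in> Poly_Mapping.keys p" "b \<in> Poly_Mapping.keys q"
        using subsetD[OF keys_mult m] by blast
      then show ?thesis
        using p(1) q(1) Poly_Mapping.keys_add[of a b] unfolding mpoly_vars_def by blast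
    qed
    then show ?thesis unfolding mpoly_vars_def by blast
  qed
  then show ?thesis
    unfolding polynomial_function_def
    by (intro exI[of _ "p * q"]) (simp add: mpoly_eval_mult p q)
qed

lemma polynomial_function_sum:
  "(\<And>i. i \<in> A \<Longrightarrow> polynomial_function V (f i)) \<Longrightarrow> polynomial_function V (\<lambda>k. \<Sum>i\<in>A. f i k)"
  by (induction A rule: infinite_finite_induct)
     (auto intro: polynomial_function_const polynomial_function_add)

lemma polynomial_function_prod:
  "(\<And>i. i \<in> A \<Longrightarrow> polynomial_function V (f i)) \<Longrightarrow> polynomial_function V (\<lambda>k. \<Prod>i\<in>A. f i k)"
  by (induction A rule: infinite_finite_induct)
     (auto intro: polynomial_function_const polynomial_function_mult)

section \<open>Reflections\<close>

lemma inner_coroot: "x \<bullet> coroot \<alpha> = 2 * (x \<bullet> \<alpha>) / (\<alpha> \<bullet> \<alpha>)"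
  by (simp add: coroot_def)

lemma coroot_minus [simp]: "coroot (- \<alpha>) = - coroot \<alpha>"
  by (simp add: coroot_def)

lemma inner_coroot_self: "\<alpha> \<noteq> 0 \<Longrightarrow> \<alpha> \<bullet> coroot \<alpha> = 2"
  by (simp add: coroot_def)

lemma inner_coroot_pos_iff: "x \<bullet> coroot \<alpha> > 0 \<longleftrightarrow> x \<bullet> \<alpha> > 0"
proof (cases "\<alpha> = 0")
  case False
  define c where "c = 2 / (\<alpha> \<bullet> \<alpha>)"
  have "c > 0" "x \<bullet> coroot \<alpha> = c * (x \<bullet> \<alpha>)"
    using False by (simp_all add: c_def coroot_def)
  then show ?thesis by (simp add: zero_less_mult_iff)
qed (simp add: inner_coroot)

lemma inner_coroot_eq_0_iff: "x \<bullet> coroot \<alpha> = 0 \<longleftrightarrow> x \<bullet> \<alpha> = 0"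
  by (cases "\<alpha> = 0") (auto simp: inner_coroot)

lemma linear_root_reflection: "linear (root_reflection \<alpha>)"
  unfolding root_reflection_def
  by (intro linearI) (simp_all add: algebra_simps inner_add_left)

text \<open>
  Reflections in \<open>\<alpha>\<close> and in its coroot coincide, so roots and coroots may change places in the
  formula.
\<close>

lemma root_reflection_coroot: "root_reflection \<alpha> v = v - (v \<bullet> \<alpha>) *\<^sub>R coroot \<alpha>"
  by (simp add: root_reflection_def coroot_def)

lemma root_reflection_inner [simp]: "root_reflection \<alpha> x \<bullet> root_reflection \<alpha> y = x \<bullet> y"
proof -
  define p q where "p = x \<bullet> coroot \<alpha>" and "q = y \<bullet> coroot \<alpha>"
  have "p * (\<alpha> \<bullet> \<alpha>) = 2 * (x \<bullet> \<alpha>)" "q * (\<alpha> \<bullet> \<alpha>) = 2 * (y \<bullet> \<alpha>)"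
    by (cases "\<alpha> = 0"; simp add: p_def q_def inner_coroot)+
  moreover have "root_reflection \<alpha> x \<bullet> root_reflection \<alpha> y
      = x \<bullet> y - q * (x \<bullet> \<alpha>) - p * (y \<bullet> \<alpha>) + p * q * (\<alpha> \<bullet> \<alpha>)"
    by (simp add: root_reflection_def inner_diff_left inner_diff_right
        inner_commute[of \<alpha> y] right_diff_distrib flip: p_def q_def)
  ultimately show ?thesis by algebra
qed

lemma root_reflection_involutive [simp]: "root_reflection \<alpha> (root_reflection \<alpha> v) = v"
proof (cases "\<alpha> = 0")
  case False
  then show ?thesis
    by (simp add: root_reflection_def inner_diff_left inner_coroot_self algebra_simps)
qed (simp add: root_reflection_def)

lemma root_reflection_adjoint: "root_reflection \<alpha> x \<bullet> y = x \<bullet> root_reflection \<alpha> y"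
  by (metis root_reflection_inner root_reflection_involutive)

lemma root_reflection_self [simp]: "root_reflection \<alpha> \<alpha> = - \<alpha>"
  by (cases "\<alpha> = 0") (simp_all add: root_reflection_def inner_coroot_self scaleR_2)

lemma root_reflection_uminus_root [simp]: "root_reflection (- \<alpha>) = root_reflection \<alpha>"
  by (simp add: root_reflection_def fun_eq_iff)

lemma orthogonal_root_reflection: "orthogonal_transformation (root_reflection \<alpha>)"
  by (simp add: orthogonal_transformation_def linear_root_reflection)

lemma coroot_orthogonal:
  assumes "orthogonal_transformation f"
  shows "coroot (f \<alpha>) = f (coroot \<alpha>)"
  using assms unfolding orthogonal_transformation_def coroot_def
  by (simp add: linear_scale)

lemma coroot_reflection:
  "coroot (root_reflection \<gamma> \<delta>) = coroot \<delta> - (\<gamma> \<bullet> coroot \<delta>) *\<^sub>R coroot \<gamma>"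
  unfolding coroot_orthogonal[OF orthogonal_root_reflection]
  by (simp add: root_reflection_coroot inner_commute)

lemma root_reflection_conjugate:
  assumes "orthogonal_transformation f"
  shows "root_reflection (f \<alpha>) (f v) = f (root_reflection \<alpha> v)"
  using assms coroot_orthogonal[OF assms, of \<alpha>]
  unfolding orthogonal_transformation_def root_reflection_def
  by (simp add: linear_diff linear_scale)

text \<open>
  Behind \<open>\<langle>\<rho>, \<gamma>\<^sup>\<or>\<rangle> = 1\<close>: the reflection permutes \<open>A - {\<gamma>}\<close> and reverses the sign of the pairing
  with \<open>\<gamma>\<^sup>\<or>\<close>, so only \<open>\<gamma>\<close> itself contributes.  It is applied both to all positive roots and to those
  of the Levi factor.
\<close>

lemma sum_inner_coroot:
  assumes "finite A" "\<gamma> \<in> A" "\<gamma> \<noteq> 0" "root_reflection \<gamma> ` (A - {\<gamma>}) \<subseteq> A - {\<gamma>}"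
  shows "(\<Sum>A) \<bullet> coroot \<gamma> = 2"
proof -
  let ?B = "A - {\<gamma>}"
  have bij: "bij_betw (root_reflection \<gamma>) ?B ?B"
    by (rule bij_betw_byWitness[where f' = "root_reflection \<gamma>"]) (use assms in auto)
  have "(\<Sum>\<alpha>\<in>?B. \<alpha> \<bullet> coroot \<gamma>) = (\<Sum>\<alpha>\<in>?B. root_reflection \<gamma> \<alpha> \<bullet> coroot \<gamma>)"
    using sum.reindex_bij_betw[OF bij, of "\<lambda>\<alpha>. \<alpha> \<bullet> coroot \<gamma>"] by simp
  also have "\<dots> = (\<Sum>\<alpha>\<in>?B. - (\<alpha> \<bullet> coroot \<gamma>))"
    using assms(3) by (intro sum.cong refl)
      (simp add: root_reflection_def inner_diff_left inner_coroot_self)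
  finally have "(\<Sum>\<alpha>\<in>?B. \<alpha> \<bullet> coroot \<gamma>) = 0"
    by (simp add: sum_negf)
  then show ?thesis
    using assms
    by (subst sum.remove[of A \<gamma>]) (simp_all add: inner_add_left inner_sum_left inner_coroot_self)
qed

text \<open>
  Words keep track of a length, on which the exchange argument below is an induction.
\<close>

definition reflection_word :: "'a::euclidean_space list \<Rightarrow> 'a \<Rightarrow> 'a" where
  "reflection_word \<gamma>s = foldr (\<lambda>\<gamma> w. root_reflection \<gamma> \<circ> w) \<gamma>s id"

lemma reflection_word_simps [simp]:
  "reflection_word [] = id"
  "reflection_word (\<gamma> # \<gamma>s) = root_reflection \<gamma> \<circ> reflection_word \<gamma>s"
  by (simp_all add: reflection_word_def)

lemma reflection_word_append [simp]:
  "reflection_word (\<gamma>s @ \<delta>s) = reflection_word \<gamma>s \<circ> reflection_word \<delta>s"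
  by (induction \<gamma>s) (simp_all add: comp_assoc)

lemma reflection_word_rev [simp]: "reflection_word (rev \<gamma>s) (reflection_word \<gamma>s v) = v"
  by (induction \<gamma>s) simp_all

lemma reflection_word_rev' [simp]: "reflection_word \<gamma>s (reflection_word (rev \<gamma>s) v) = v"
  using reflection_word_rev[of "rev \<gamma>s"] by simp

lemma orthogonal_reflection_word: "orthogonal_transformation (reflection_word \<gamma>s)"
proof (induction \<gamma>s)
  case Nil
  show ?case by (simp add: orthogonal_transformation_def linear_id)
next
  case (Cons \<gamma> \<gamma>s)
  then show ?case
    by (simp only: reflection_word_simps orthogonal_transformation_compose
        orthogonal_root_reflection)
qed

lemma linear_reflection_word: "linear (reflection_word \<gamma>s)"
  using orthogonal_reflection_word by (auto simp: orthogonal_transformation_def)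

lemma reflection_word_inner [simp]: "reflection_word \<gamma>s x \<bullet> reflection_word \<gamma>s y = x \<bullet> y"
  using orthogonal_reflection_word by (auto simp: orthogonal_transformation_def)

lemma reflection_word_adjoint: "reflection_word \<gamma>s x \<bullet> y = x \<bullet> reflection_word (rev \<gamma>s) y"
  by (metis reflection_word_inner reflection_word_rev')

lemma reflection_word_minus [simp]: "reflection_word \<gamma>s (- v) = - reflection_word \<gamma>s v"
  using linear_reflection_word linear_neg by blast

lemma reflection_word_in_span:
  "set \<gamma>s \<subseteq> A \<Longrightarrow> reflection_word \<gamma>s v - v \<in> span A"
proof (induction \<gamma>s)
  case (Cons \<gamma> \<gamma>s)
  have "reflection_word (\<gamma> # \<gamma>s) v - v
      = (reflection_word \<gamma>s v - v) - (reflection_word \<gamma>s v \<bullet> coroot \<gamma>) *\<^sub>R \<gamma>"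
    by (simp add: root_reflection_def)
  then show ?case
    using Cons by (simp only:) (simp add: span_diff span_scale span_base)
qed (simp add: span_zero)

lemma reflection_word_in_group: "set \<gamma>s \<subseteq> A \<Longrightarrow> reflection_word \<gamma>s \<in> reflection_group A"
  by (induction \<gamma>s) (auto intro: reflection_group.intros)

section \<open>Positive roots and simple roots\<close>

text \<open>
  The linear form \<open>\<xi>\<close> cutting out the positive roots is part of the data because it provides the
  measure for inductions over positive roots.
\<close>

locale root_data =
  fixes R Rp :: "'a::euclidean_space set" and \<xi> :: 'a
  assumes root_system: "root_system R"
    and regular: "\<And>\<alpha>. \<alpha> \<in> R \<Longrightarrow> \<xi> \<bullet> \<alpha> \<noteq> 0"
    and positive_eq: "Rp = {\<alpha>\<in>R. \<xi> \<bullet> \<alpha> > 0}"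
begin

abbreviation "S \<equiv> simple_roots Rp"

lemma finite_R: "finite R" and zero_notin_R: "0 \<notin> R" and span_R: "span R = UNIV"
  using root_system by (simp_all add: root_system_def)

lemma reflection_R: "\<alpha> \<in> R \<Longrightarrow> \<delta> \<in> R \<Longrightarrow> root_reflection \<alpha> \<delta> \<in> R"
  using root_system unfolding root_system_def by (metis imageI)

lemma cartan_integer: "\<alpha> \<in> R \<Longrightarrow> \<delta> \<in> R \<Longrightarrow> \<alpha> \<bullet> coroot \<delta> \<in> \<int>"
  using root_system by (simp add: root_system_def)

lemma reduced: "\<alpha> \<in> R \<Longrightarrow> c *\<^sub>R \<alpha> \<in> R \<Longrightarrow> c = 1 \<or> c = - 1"
  using root_system by (simp add: root_system_def)

lemma minus_in_R: "\<alpha> \<in> R \<Longrightarrow> - \<alpha> \<in> R"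
  using reflection_R[of \<alpha> \<alpha>] by simp

lemma Rp_subset: "Rp \<subseteq> R" and S_subset: "S \<subseteq> Rp"
  by (auto simp: positive_eq simple_roots_def)

lemma S_in_R: "\<gamma> \<in> S \<Longrightarrow> \<gamma> \<in> R"
  using Rp_subset S_subset by blast

lemma finite_Rp: "finite Rp" and finite_S: "finite S"
  using finite_R Rp_subset S_subset by (auto dest: finite_subset)

lemma positive_or_negative: "\<alpha> \<in> R \<Longrightarrow> \<alpha> \<in> Rp \<or> - \<alpha> \<in> Rp"
  using regular[of \<alpha>] minus_in_R[of \<alpha>] by (auto simp: positive_eq)

lemma not_positive_and_negative: "\<alpha> \<in> Rp \<Longrightarrow> - \<alpha> \<notin> Rp"
  by (auto simp: positive_eq)

lemma positive_xi: "\<alpha> \<in> Rp \<Longrightarrow> \<xi> \<bullet> \<alpha> > 0"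
  by (simp add: positive_eq)

lemma nonzero: "\<alpha> \<in> R \<Longrightarrow> \<alpha> \<noteq> 0"
  using zero_notin_R by blast

lemma positive_root_induct [consumes 1, case_names less]:
  assumes "\<alpha> \<in> Rp"
    and "\<And>\<alpha>. \<alpha> \<in> Rp \<Longrightarrow> (\<And>\<delta>. \<delta> \<in> Rp \<Longrightarrow> \<xi> \<bullet> \<delta> < \<xi> \<bullet> \<alpha> \<Longrightarrow> P \<delta>) \<Longrightarrow> P \<alpha>"
  shows "P \<alpha>"
  using assms(1)
proof (induction "card {\<delta>\<in>Rp. \<xi> \<bullet> \<delta> < \<xi> \<bullet> \<alpha>}" arbitrary: \<alpha> rule: less_induct)
  case less
  show ?case
  proof (rule assms(2)[OF less.prems])
    fix \<delta> assume \<delta>: "\<delta> \<in> Rp" "\<xi> \<bullet> \<delta> < \<xi> \<bullet> \<alpha>"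
    then have "{\<epsilon>\<in>Rp. \<xi> \<bullet> \<epsilon> < \<xi> \<bullet> \<delta>} \<subset> {\<epsilon>\<in>Rp. \<xi> \<bullet> \<epsilon> < \<xi> \<bullet> \<alpha>}"
      by auto
    then show "P \<delta>"
      using less.hyps \<delta> finite_Rp by (simp add: psubset_card_mono)
  qed
qed

lemma positive_root_combination:
  assumes "\<alpha> \<in> Rp"
  shows "\<exists>c :: 'a \<Rightarrow> nat. \<alpha> = (\<Sum>\<gamma>\<in>S. of_nat (c \<gamma>) *\<^sub>R \<gamma>)"
  using assms
proof (induction rule: positive_root_induct)
  case (less \<alpha>)
  show ?case
  proof (cases "\<alpha> \<in> S")
    case True
    define e :: "'a \<Rightarrow> nat" where "e \<gamma> = (if \<gamma> = \<alpha> then 1 else 0)" for \<gamma>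
    have "(\<Sum>\<gamma>\<in>S. of_nat (e \<gamma>) *\<^sub>R \<gamma>) = (\<Sum>\<gamma>\<in>S. if \<gamma> = \<alpha> then \<gamma> else 0)"
      by (rule sum.cong) (auto simp: e_def)
    also have "\<dots> = \<alpha>" using True finite_S by (simp add: sum.delta)
    finally have "\<alpha> = (\<Sum>\<gamma>\<in>S. of_nat (e \<gamma>) *\<^sub>R \<gamma>)" by (rule sym)
    then show ?thesis by blast
  next
    case False
    then obtain \<delta> \<epsilon> where \<delta>: "\<delta> \<in> Rp" "\<epsilon> \<in> Rp" "\<alpha> = \<delta> + \<epsilon>"
      using less(1) unfolding simple_roots_def by blast
    then have "\<xi> \<bullet> \<delta> < \<xi> \<bullet> \<alpha>" "\<xi> \<bullet> \<epsilon> < \<xi> \<bullet> \<alpha>"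
      using positive_xi by (auto simp: inner_add_right)
    then obtain c d :: "'a \<Rightarrow> nat" where
      cd: "\<delta> = (\<Sum>\<gamma>\<in>S. of_nat (c \<gamma>) *\<^sub>R \<gamma>)" "\<epsilon> = (\<Sum>\<gamma>\<in>S. of_nat (d \<gamma>) *\<^sub>R \<gamma>)"
      using less.IH[OF \<delta>(1)] less.IH[OF \<delta>(2)] by blast
    define e where "e \<gamma> = c \<gamma> + d \<gamma>" for \<gamma>
    have "\<alpha> = (\<Sum>\<gamma>\<in>S. of_nat (e \<gamma>) *\<^sub>R \<gamma>)"
      unfolding \<delta>(3) e_def
      by (subst cd(1), subst cd(2)) (simp add: scaleR_left_distrib sum.distrib)
    then show ?thesis by blast
  qed
qed

lemma span_S: "span S = UNIV"
proof -
  have pos: "\<alpha> \<in> span S" if \<alpha>: "\<alpha> \<in> Rp" for \<alpha>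
  proof -
    obtain c :: "'a \<Rightarrow> nat" where c: "\<alpha> = (\<Sum>\<gamma>\<in>S. of_nat (c \<gamma>) *\<^sub>R \<gamma>)"
      using positive_root_combination[OF \<alpha>] by blast
    show ?thesis by (subst c) (intro span_sum span_scale span_base)
  qed
  have "R \<subseteq> span S"
  proof
    fix \<alpha> assume "\<alpha> \<in> R"
    then show "\<alpha> \<in> span S"
      using positive_or_negative[of \<alpha>] pos[of \<alpha>] pos[of "- \<alpha>"] span_neg[of "- \<alpha>" S] by auto
  qed
  then show ?thesis using span_R span_minimal[OF _ subspace_span] by blast
qed

text \<open>
  If both Cartan integers were at least \<open>2\<close>, then \<open>\<langle>\<delta>, \<gamma>\<rangle>\<close> would be at least each squared length,
  which forces \<open>\<parallel>\<delta> - \<gamma>\<parallel>\<^sup>2 \<le> 0\<close>.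
\<close>

lemma cartan_integer_one:
  assumes "\<delta> \<in> R" "\<gamma> \<in> R" "\<delta> \<noteq> \<gamma>" "\<delta> \<bullet> \<gamma> > 0"
  shows "\<delta> \<bullet> coroot \<gamma> = 1 \<or> \<gamma> \<bullet> coroot \<delta> = 1"
proof (rule ccontr)
  have int: "x \<ge> 2" if "x \<in> \<int>" "x > 0" "x \<noteq> 1" for x :: real
    using that by (elim Ints_cases) auto
  assume "\<not> ?thesis"
  moreover have "\<delta> \<bullet> coroot \<gamma> > 0" "\<gamma> \<bullet> coroot \<delta> > 0"
    using assms(4) by (simp_all add: inner_coroot_pos_iff inner_commute)
  ultimately have "\<delta> \<bullet> coroot \<gamma> \<ge> 2" "\<gamma> \<bullet> coroot \<delta> \<ge> 2"
    using int cartan_integer assms(1,2) by blast+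
  then have "2 * (\<gamma> \<bullet> \<gamma>) \<le> 2 * (\<delta> \<bullet> \<gamma>)" "2 * (\<delta> \<bullet> \<delta>) \<le> 2 * (\<delta> \<bullet> \<gamma>)"
    using nonzero[OF assms(1)] nonzero[OF assms(2)]
    by (simp_all add: inner_coroot pos_le_divide_eq inner_commute)
  then have "(\<delta> - \<gamma>) \<bullet> (\<delta> - \<gamma>) \<le> 0"
    by (simp add: inner_diff_left inner_diff_right inner_commute)
  moreover have "(\<delta> - \<gamma>) \<bullet> (\<delta> - \<gamma>) > 0"
    unfolding inner_gt_zero_iff using assms(3) by simp
  ultimately show False by linarith
qed

lemma difference_root:
  assumes "\<delta> \<in> R" "\<gamma> \<in> R" "\<delta> \<noteq> \<gamma>" "\<delta> \<bullet> \<gamma> > 0"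
  shows "\<delta> - \<gamma> \<in> R"
  using cartan_integer_one[OF assms] reflection_R[of \<gamma> \<delta>] reflection_R[of \<delta> \<gamma>]
    minus_in_R[of "\<gamma> - \<delta>"] assms(1,2)
  by (auto simp: root_reflection_def)

lemma difference_coroot:
  assumes "\<delta> \<in> R" "\<gamma> \<in> R" "\<delta> \<noteq> \<gamma>" "\<delta> \<bullet> \<gamma> > 0"
  shows "\<exists>\<alpha>\<in>R. coroot \<alpha> = coroot \<delta> - coroot \<gamma>"
  using cartan_integer_one[OF assms]
proof
  assume "\<gamma> \<bullet> coroot \<delta> = 1"
  then have "coroot (root_reflection \<gamma> \<delta>) = coroot \<delta> - coroot \<gamma>"
    by (simp add: coroot_reflection)
  then show ?thesis using reflection_R assms(1,2) by metis
next
  assume "\<delta> \<bullet> coroot \<gamma> = 1"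
  then have "coroot (- root_reflection \<delta> \<gamma>) = coroot \<delta> - coroot \<gamma>"
    by (simp add: coroot_reflection)
  then show ?thesis using reflection_R minus_in_R assms(1,2) by metis
qed

lemma simple_roots_obtuse:
  assumes "\<gamma> \<in> S" "\<delta> \<in> S" "\<gamma> \<noteq> \<delta>"
  shows "\<gamma> \<bullet> \<delta> \<le> 0"
proof (rule ccontr)
  assume "\<not> ?thesis"
  then have "\<gamma> - \<delta> \<in> R" using difference_root assms S_in_R by simp
  then have "\<gamma> - \<delta> \<in> Rp \<or> \<delta> - \<gamma> \<in> Rp" using positive_or_negative[of "\<gamma> - \<delta>"] by simp
  moreover have "\<gamma> = \<delta> + (\<gamma> - \<delta>)" "\<delta> = \<gamma> + (\<delta> - \<gamma>)" by simp_all
  ultimately show False using assms unfolding simple_roots_def by blast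
qed

text \<open>
  In a linear relation, bring the negative coefficients to the other side.  Both sides equal a vector
  \<open>z\<close> with \<open>\<langle>z, z\<rangle> \<le> 0\<close>, since distinct simple roots make obtuse angles.  So \<open>z = 0\<close>; but \<open>\<xi>\<close> is
  positive on simple roots, so both sides are empty sums.
\<close>

lemma independent_S: "independent S"
proof -
  have "u \<gamma> = 0" if u: "(\<Sum>\<gamma>\<in>S. u \<gamma> *\<^sub>R \<gamma>) = 0" and \<gamma>: "\<gamma> \<in> S" for u \<gamma>
  proof -
    define P where "P = {\<gamma>\<in>S. u \<gamma> > 0}"
    define M where "M = {\<gamma>\<in>S. u \<gamma> < 0}"
    have fin: "finite P" "finite M" using finite_S by (auto simp: P_def M_def)
    define z where "z = (\<Sum>\<gamma>\<in>P. u \<gamma> *\<^sub>R \<gamma>)"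
    have "(\<Sum>\<gamma>\<in>S. u \<gamma> *\<^sub>R \<gamma>) = (\<Sum>\<gamma>\<in>P \<union> M. u \<gamma> *\<^sub>R \<gamma>)"
      using finite_S by (intro sum.mono_neutral_right) (auto simp: P_def M_def)
    also have "\<dots> = z + (\<Sum>\<gamma>\<in>M. u \<gamma> *\<^sub>R \<gamma>)"
      unfolding z_def using fin by (intro sum.union_disjoint) (auto simp: P_def M_def)
    finally have z': "z = - (\<Sum>\<gamma>\<in>M. u \<gamma> *\<^sub>R \<gamma>)"
      using u by (simp add: eq_neg_iff_add_eq_0)
    have "z \<bullet> z = (\<Sum>\<delta>\<in>M. \<Sum>\<gamma>\<in>P. (u \<gamma> * - u \<delta>) * (\<gamma> \<bullet> \<delta>))"
      by (subst (2) z') (simp add: z_def inner_sum_left inner_sum_right sum_negf sum_distrib_left ac_simps)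
    also have "\<dots> \<le> 0"
    proof (intro sum_nonpos mult_nonneg_nonpos)
      fix \<delta> \<gamma> assume "\<delta> \<in> M" "\<gamma> \<in> P"
      then show "0 \<le> u \<gamma> * - u \<delta>" "\<gamma> \<bullet> \<delta> \<le> 0"
        by (auto simp: P_def M_def mult_le_0_iff intro!: simple_roots_obtuse)
    qed
    finally have "z = 0" by (metis inner_eq_zero_iff inner_ge_zero order_antisym)
    then have "(\<Sum>\<gamma>\<in>P. u \<gamma> * (\<xi> \<bullet> \<gamma>)) = 0" "(\<Sum>\<gamma>\<in>M. (- u \<gamma>) * (\<xi> \<bullet> \<gamma>)) = 0"
      using arg_cong[OF z_def, of "\<lambda>z. \<xi> \<bullet> z"] arg_cong[OF z', of "\<lambda>z. \<xi> \<bullet> z"]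
      by (simp_all add: inner_sum_right sum_negf)
    moreover have "u \<gamma> * (\<xi> \<bullet> \<gamma>) > 0" if "\<gamma> \<in> P" for \<gamma>
      using that positive_xi S_subset by (auto simp: P_def)
    moreover have "(- u \<gamma>) * (\<xi> \<bullet> \<gamma>) > 0" if "\<gamma> \<in> M" for \<gamma>
      using that positive_xi S_subset by (auto simp: M_def mult_less_0_iff)
    ultimately have "P = {}" "M = {}"
      using sum_pos[OF fin(1), of "\<lambda>\<gamma>. u \<gamma> * (\<xi> \<bullet> \<gamma>)"]
        sum_pos[OF fin(2), of "\<lambda>\<gamma>. (- u \<gamma>) * (\<xi> \<bullet> \<gamma>)"] by fastforce+
    then show "u \<gamma> = 0" using \<gamma> by (force simp: P_def M_def)
  qed
  note zero = this
  show ?thesis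
  proof
    assume "dependent S"
    then obtain u where u: "(\<Sum>\<gamma>\<in>S. u \<gamma> *\<^sub>R \<gamma>) = 0" and "\<exists>\<gamma>\<in>S. u \<gamma> \<noteq> 0"
      unfolding dependent_finite[OF finite_S] by blast
    then show False using zero[OF u] by simp
  qed
qed

lemma simple_notin_span:
  assumes "\<gamma> \<in> S - I" "I \<subseteq> S"
  shows "\<gamma> \<notin> span I"
proof
  assume "\<gamma> \<in> span I"
  moreover have "I \<subseteq> S - {\<gamma>}" using assms by blast
  ultimately have "\<gamma> \<in> span (S - {\<gamma>})" using span_mono by blast
  then show False using independent_S assms(1) unfolding dependent_def by blast
qed

text \<open>
  The right-hand side is easier to work with: it is clearly stable under reflections that keep a
  root positive.  The two sides agree because the expansion of a root in simple roots is unique.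
\<close>

lemma positive_roots_in_span:
  assumes I: "I \<subseteq> S"
  shows "{\<alpha>\<in>Rp. \<exists>c :: 'a \<Rightarrow> nat. \<alpha> = (\<Sum>\<gamma>\<in>I. of_nat (c \<gamma>) *\<^sub>R \<gamma>)} = Rp \<inter> span I"
proof (intro equalityI subsetI)
  fix \<alpha> assume "\<alpha> \<in> Rp \<inter> span I"
  then have \<alpha>: "\<alpha> \<in> Rp" "\<alpha> \<in> span I" by auto
  obtain c :: "'a \<Rightarrow> nat" where c: "\<alpha> = (\<Sum>\<gamma>\<in>S. of_nat (c \<gamma>) *\<^sub>R \<gamma>)"
    using positive_root_combination[OF \<alpha>(1)] by blast
  obtain d where d: "\<alpha> = (\<Sum>\<gamma>\<in>I. d \<gamma> *\<^sub>R \<gamma>)"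
    using \<alpha>(2) span_finite[OF finite_subset[OF I finite_S]] by auto
  define d' where "d' \<gamma> = (if \<gamma> \<in> I then d \<gamma> else 0)" for \<gamma>
  have "\<alpha> = (\<Sum>\<gamma>\<in>S. d' \<gamma> *\<^sub>R \<gamma>)"
    unfolding d using I finite_S by (intro sum.mono_neutral_cong_left) (auto simp: d'_def)
  then have "(\<Sum>\<gamma>\<in>S. (of_nat (c \<gamma>) - d' \<gamma>) *\<^sub>R \<gamma>) = 0"
    using c by (simp add: scaleR_left_diff_distrib sum_subtractf)
  then have "of_nat (c \<gamma>) = d' \<gamma>" if "\<gamma> \<in> S" for \<gamma>
    using independentD[OF independent_S finite_S order_refl, of "\<lambda>\<gamma>. of_nat (c \<gamma>) - d' \<gamma>"] that
    by simp
  then have "\<alpha> = (\<Sum>\<gamma>\<in>I. of_nat (c \<gamma>) *\<^sub>R \<gamma>)"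
    using d I by (auto simp: d'_def intro!: sum.cong)
  then show "\<alpha> \<in> {\<alpha>\<in>Rp. \<exists>c :: 'a \<Rightarrow> nat. \<alpha> = (\<Sum>\<gamma>\<in>I. of_nat (c \<gamma>) *\<^sub>R \<gamma>)}"
    using \<alpha>(1) by blast
next
  fix \<alpha> assume "\<alpha> \<in> {\<alpha>\<in>Rp. \<exists>c :: 'a \<Rightarrow> nat. \<alpha> = (\<Sum>\<gamma>\<in>I. of_nat (c \<gamma>) *\<^sub>R \<gamma>)}"
  then obtain c :: "'a \<Rightarrow> nat" where c: "\<alpha> \<in> Rp" "\<alpha> = (\<Sum>\<gamma>\<in>I. of_nat (c \<gamma>) *\<^sub>R \<gamma>)"
    by blast
  have "(\<Sum>\<gamma>\<in>I. of_nat (c \<gamma>) *\<^sub>R \<gamma>) \<in> span I"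
    by (intro span_sum span_scale span_base)
  then show "\<alpha> \<in> Rp \<inter> span I" using c by simp
qed

text \<open>
  Induction on the Cartan integer \<open>m\<close> of \<open>\<alpha>\<close> with \<open>\<gamma>\<close>.  For \<open>m > 0\<close> the root \<open>\<alpha> - \<gamma>\<close> is
  positive, because \<open>\<gamma>\<close> is indecomposable, and by induction its image \<open>s\<^sub>\<gamma> \<alpha> + \<gamma>\<close> is positive.
  If \<open>s\<^sub>\<gamma> \<alpha>\<close> were negative, \<open>\<gamma>\<close> would be the sum of the positive roots \<open>s\<^sub>\<gamma> \<alpha> + \<gamma>\<close> and
  \<open>- s\<^sub>\<gamma> \<alpha>\<close>.
\<close>

lemma simple_reflection_positive:
  assumes "\<gamma> \<in> S" "\<alpha> \<in> Rp" "\<alpha> \<noteq> \<gamma>"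
  shows "root_reflection \<gamma> \<alpha> \<in> Rp"
proof -
  have \<gamma>R: "\<gamma> \<in> R" "\<gamma> \<in> Rp" and \<alpha>R: "\<alpha> \<in> R" using assms S_subset Rp_subset by auto
  have "\<alpha> \<bullet> coroot \<gamma> \<in> \<int>" using cartan_integer \<alpha>R \<gamma>R by blast
  then obtain m where m: "\<alpha> \<bullet> coroot \<gamma> = of_int m" by (elim Ints_cases)
  show ?thesis
    using assms(2,3) m
  proof (induction "nat m" arbitrary: m \<alpha> rule: less_induct)
    case less
    have \<alpha>R: "\<alpha> \<in> R" using less.prems Rp_subset by auto
    have refl: "root_reflection \<gamma> \<alpha> \<in> R" using reflection_R \<gamma>R \<alpha>R by blast
    show ?case
    proof (cases "m \<le> 0")
      case True
      then have "\<xi> \<bullet> root_reflection \<gamma> \<alpha> > 0"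
        using positive_xi[OF less.prems(1)] positive_xi[OF \<gamma>R(2)] less.prems(3)
          mult_nonpos_nonneg[of "of_int m" "\<xi> \<bullet> \<gamma>"]
        by (simp add: root_reflection_def inner_diff_right)
      then show ?thesis using refl by (simp add: positive_eq)
    next
      case False
      then have "\<alpha> \<bullet> \<gamma> > 0" using less.prems(3) inner_coroot_pos_iff[of \<alpha> \<gamma>] by simp
      then have diffR: "\<alpha> - \<gamma> \<in> R" using difference_root \<alpha>R \<gamma>R less.prems(2) by blast
      have "\<gamma> - \<alpha> \<notin> Rp"
      proof
        assume "\<gamma> - \<alpha> \<in> Rp"
        moreover have "\<gamma> = \<alpha> + (\<gamma> - \<alpha>)" by simp
        ultimately show False using assms(1) less.prems(1) unfolding simple_roots_def by blast
      qed
      then have diff: "\<alpha> - \<gamma> \<in> Rp" using positive_or_negative[OF diffR] by simp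
      have "\<alpha> - \<gamma> \<noteq> \<gamma>"
      proof
        assume "\<alpha> - \<gamma> = \<gamma>"
        then have "\<alpha> = 2 *\<^sub>R \<gamma>" by (simp add: scaleR_2 algebra_simps)
        then show False using reduced[OF \<gamma>R(1), of 2] \<alpha>R by auto
      qed
      moreover have "(\<alpha> - \<gamma>) \<bullet> coroot \<gamma> = of_int (m - 2)"
        using less.prems(3) nonzero[OF \<gamma>R(1)] by (simp add: inner_diff_left inner_coroot_self)
      ultimately have "root_reflection \<gamma> (\<alpha> - \<gamma>) \<in> Rp"
        using less.hyps[of "m - 2" "\<alpha> - \<gamma>"] diff False by simp
      moreover have "root_reflection \<gamma> (\<alpha> - \<gamma>) = root_reflection \<gamma> \<alpha> + \<gamma>"
        using linear_diff[OF linear_root_reflection, of \<gamma> \<alpha> \<gamma>] by simp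
      ultimately have up: "root_reflection \<gamma> \<alpha> + \<gamma> \<in> Rp" by simp
      have "- root_reflection \<gamma> \<alpha> \<notin> Rp"
      proof
        assume neg: "- root_reflection \<gamma> \<alpha> \<in> Rp"
        have "\<gamma> = (root_reflection \<gamma> \<alpha> + \<gamma>) + - root_reflection \<gamma> \<alpha>" by simp
        then show False using assms(1) up neg unfolding simple_roots_def by blast
      qed
      then show ?thesis using positive_or_negative[OF refl] by blast
    qed
  qed
qed

lemma simple_reflection_permutes:
  assumes "\<gamma> \<in> S"
  shows "root_reflection \<gamma> ` (Rp - {\<gamma>}) \<subseteq> Rp - {\<gamma>}"
proof -
  have "root_reflection \<gamma> \<alpha> \<noteq> \<gamma>" if "\<alpha> \<in> Rp" for \<alpha>
  proof
    assume "root_reflection \<gamma> \<alpha> = \<gamma>"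
    then have "\<alpha> = - \<gamma>" by (metis root_reflection_involutive root_reflection_self)
    then show False using that assms S_subset not_positive_and_negative[of \<gamma>] by auto
  qed
  then show ?thesis using simple_reflection_positive[OF assms] by auto
qed

lemma simple_reflection_bij:
  assumes "\<gamma> \<in> S"
  shows "bij_betw (root_reflection \<gamma>) (Rp - {\<gamma>}) (Rp - {\<gamma>})"
  by (rule bij_betw_byWitness[where f' = "root_reflection \<gamma>"])
    (rule ballI root_reflection_involutive simple_reflection_permutes[OF assms])+

lemma rho_coroot:
  assumes "\<gamma> \<in> S"
  shows "rho Rp \<bullet> coroot \<gamma> = 1"
proof -
  have "\<gamma> \<in> Rp" "\<gamma> \<noteq> 0" using assms S_subset S_in_R nonzero by blast+
  then have "\<Sum>Rp \<bullet> coroot \<gamma> = 2"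
    using sum_inner_coroot[OF finite_Rp] simple_reflection_permutes[OF assms] by blast
  then show ?thesis by (simp only: rho_def inner_scaleR_left)
qed

lemma simple_root_acute:
  assumes "\<alpha> \<in> Rp"
  shows "\<exists>\<gamma>\<in>S. \<alpha> \<bullet> \<gamma> > 0"
proof (rule ccontr)
  assume "\<not> ?thesis"
  then have le: "\<alpha> \<bullet> \<gamma> \<le> 0" if "\<gamma> \<in> S" for \<gamma>
    using that by (simp add: not_less)
  obtain c :: "'a \<Rightarrow> nat" where c: "\<alpha> = (\<Sum>\<gamma>\<in>S. of_nat (c \<gamma>) *\<^sub>R \<gamma>)"
    using positive_root_combination[OF assms] by blast
  have "\<alpha> \<bullet> \<alpha> = (\<Sum>\<gamma>\<in>S. of_nat (c \<gamma>) * (\<alpha> \<bullet> \<gamma>))"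
    by (subst (2) c) (simp add: inner_sum_right)
  also have "\<dots> \<le> 0" by (intro sum_nonpos mult_nonneg_nonpos le of_nat_0_le_iff)
  finally have "\<alpha> = 0" by (metis inner_eq_zero_iff inner_ge_zero order_antisym)
  moreover have "\<alpha> \<noteq> 0" by (rule nonzero[OF subsetD[OF Rp_subset assms]])
  ultimately show False by simp
qed

lemma pos_on_positive_roots:
  assumes "\<And>\<gamma>. \<gamma> \<in> I \<Longrightarrow> x \<bullet> \<gamma> > 0" "I \<subseteq> S" "\<alpha> \<in> Rp \<inter> span I"
  shows "x \<bullet> \<alpha> > 0"
proof -
  obtain c :: "'a \<Rightarrow> nat" where c: "\<alpha> = (\<Sum>\<gamma>\<in>I. of_nat (c \<gamma>) *\<^sub>R \<gamma>)"
    using positive_roots_in_span[OF assms(2)] assms(3) by blast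
  have fin: "finite I" using assms(2) finite_S finite_subset by blast
  have "\<alpha> \<in> Rp" using assms(3) by simp
  then have "\<alpha> \<noteq> 0" by (rule nonzero[OF subsetD[OF Rp_subset]])
  then obtain \<gamma> where \<gamma>: "\<gamma> \<in> I" "c \<gamma> \<noteq> 0"
    using c sum.neutral[of I "\<lambda>\<gamma>. of_nat (c \<gamma>) *\<^sub>R \<gamma>"] by auto
  have "x \<bullet> \<alpha> = (\<Sum>\<gamma>\<in>I. of_nat (c \<gamma>) * (x \<bullet> \<gamma>))"
    by (subst c) (simp add: inner_sum_right)
  also have "\<dots> > 0"
    using \<gamma> assms(1) by (intro sum_pos2[OF fin \<gamma>(1)]) (auto simp: less_imp_le)
  finally show ?thesis .
qed

lemma strictly_dominant_pos:
  assumes "\<And>\<gamma>. \<gamma> \<in> S \<Longrightarrow> x \<bullet> \<gamma> > 0" "\<alpha> \<in> Rp"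
  shows "x \<bullet> \<alpha> > 0"
proof (rule pos_on_positive_roots[OF assms(1)])
  show "\<alpha> \<in> Rp \<inter> span S" using assms(2) span_S by simp
qed simp_all

lemma rho_pos:
  assumes "\<alpha> \<in> Rp"
  shows "rho Rp \<bullet> \<alpha> > 0"
proof (rule strictly_dominant_pos[OF _ assms])
  fix \<gamma> assume "\<gamma> \<in> S"
  then have "rho Rp \<bullet> coroot \<gamma> > 0" by (simp add: rho_coroot)
  then show "rho Rp \<bullet> \<gamma> > 0" by (simp only: inner_coroot_pos_iff)
qed

section \<open>The Weyl group\<close>

lemma reflection_word_R:
  assumes "set \<gamma>s \<subseteq> R" "\<alpha> \<in> R"
  shows "reflection_word \<gamma>s \<alpha> \<in> R"
  using assms by (induction \<gamma>s) (simp_all add: reflection_R)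

lemma simple_word_R: "set \<gamma>s \<subseteq> S \<Longrightarrow> \<alpha> \<in> R \<Longrightarrow> reflection_word \<gamma>s \<alpha> \<in> R"
  using reflection_word_R[of \<gamma>s \<alpha>] S_in_R by (simp add: subset_iff)

text \<open>
  Reflecting \<open>\<alpha>\<close> in a simple root \<open>\<gamma>\<close> at an acute angle yields a lower positive root \<open>\<delta>\<close>, and the
  reflection in \<open>\<alpha>\<close> is the conjugate by \<open>s\<^sub>\<gamma>\<close> of the reflection in \<open>\<delta>\<close>.
\<close>

lemma root_reflection_simple_word:
  assumes "\<alpha> \<in> Rp"
  shows "\<exists>\<gamma>s. set \<gamma>s \<subseteq> S \<and> root_reflection \<alpha> = reflection_word \<gamma>s"
  using assms
proof (induction rule: positive_root_induct)
  case (less \<alpha>)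
  show ?case
  proof (cases "\<alpha> \<in> S")
    case True
    then show ?thesis by (intro exI[of _ "[\<alpha>]"]) simp
  next
    case False
    obtain \<gamma> where \<gamma>: "\<gamma> \<in> S" "\<alpha> \<bullet> \<gamma> > 0"
      using simple_root_acute[OF less(1)] by blast
    define \<delta> where "\<delta> = root_reflection \<gamma> \<alpha>"
    have \<delta>: "\<delta> \<in> Rp"
      unfolding \<delta>_def using simple_reflection_positive[OF \<gamma>(1) less(1)] False \<gamma>(1) by blast
    have "(\<alpha> \<bullet> coroot \<gamma>) * (\<xi> \<bullet> \<gamma>) > 0"
      using \<gamma> positive_xi S_subset by (simp add: inner_coroot_pos_iff subset_iff)
    then have "\<xi> \<bullet> \<delta> < \<xi> \<bullet> \<alpha>"
      by (simp add: \<delta>_def root_reflection_def inner_diff_right)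
    then obtain \<gamma>s where \<gamma>s: "set \<gamma>s \<subseteq> S" "root_reflection \<delta> = reflection_word \<gamma>s"
      using less.IH[OF \<delta>] by blast
    have "\<alpha> = root_reflection \<gamma> \<delta>" by (simp add: \<delta>_def)
    then have "root_reflection \<alpha> v = reflection_word (\<gamma> # \<gamma>s @ [\<gamma>]) v" for v
      using root_reflection_conjugate[OF orthogonal_root_reflection, of \<gamma> \<delta> "root_reflection \<gamma> v"] \<gamma>s(2)
      by simp
    then show ?thesis
      using \<gamma>s(1) \<gamma>(1) by (intro exI[of _ "\<gamma> # \<gamma>s @ [\<gamma>]"] conjI ext) simp_all
  qed
qed

lemma weyl_group_eq_simple_words:
  "weyl_group R = {reflection_word \<gamma>s | \<gamma>s. set \<gamma>s \<subseteq> S}"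
proof (intro equalityI subsetI)
  fix w assume "w \<in> weyl_group R"
  then have "\<exists>\<gamma>s. set \<gamma>s \<subseteq> S \<and> w = reflection_word \<gamma>s"
  proof induction
    case id
    show ?case by (rule exI[of _ "[]"]) simp
  next
    case (step w \<alpha>)
    obtain \<gamma>s where \<gamma>s: "set \<gamma>s \<subseteq> S" "w = reflection_word \<gamma>s"
      using step.IH by blast
    obtain \<delta>s where \<delta>s: "set \<delta>s \<subseteq> S" "root_reflection \<alpha> = reflection_word \<delta>s"
      using positive_or_negative[OF step.hyps(2)] root_reflection_simple_word[of \<alpha>]
        root_reflection_simple_word[of "- \<alpha>"] by auto
    show ?case
      using \<gamma>s \<delta>s by (intro exI[of _ "\<delta>s @ \<gamma>s"]) simp
  qed
  then show "w \<in> {reflection_word \<gamma>s | \<gamma>s. set \<gamma>s \<subseteq> S}" by blast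
next
  fix w assume "w \<in> {reflection_word \<gamma>s | \<gamma>s. set \<gamma>s \<subseteq> S}"
  then obtain \<gamma>s where "set \<gamma>s \<subseteq> S" "w = reflection_word \<gamma>s" by blast
  moreover from this have "set \<gamma>s \<subseteq> R" using S_subset Rp_subset by simp
  ultimately show "w \<in> weyl_group R" using reflection_word_in_group by simp
qed

text \<open>
  Some letter \<open>\<epsilon>\<close> of the word is the one that makes the image of \<open>\<gamma>\<close> negative.  At that point the
  image is \<open>\<epsilon>\<close> itself, the only positive root that \<open>s\<^sub>\<epsilon>\<close> makes negative, so that \<open>s\<^sub>\<epsilon>\<close> is a
  conjugate of \<open>s\<^sub>\<gamma>\<close> and the two cancel.
\<close>

lemma exchange:
  assumes "set \<gamma>s \<subseteq> S" "\<gamma> \<in> S" "reflection_word \<gamma>s \<gamma> \<notin> Rp"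
  shows "\<exists>\<delta>s. set \<delta>s \<subseteq> S \<and> length \<delta>s < length \<gamma>s \<and>
    reflection_word (\<gamma>s @ [\<gamma>]) = reflection_word \<delta>s"
  using assms
proof (induction \<gamma>s)
  case Nil
  then show ?case using S_subset by auto
next
  case (Cons \<epsilon> \<gamma>s)
  let ?w = "reflection_word \<gamma>s"
  show ?case
  proof (cases "?w \<gamma> \<in> Rp")
    case False
    moreover have "set \<gamma>s \<subseteq> S" using Cons.prems(1) by simp
    ultimately obtain \<delta>s where "set \<delta>s \<subseteq> S" "length \<delta>s < length \<gamma>s"
      "reflection_word (\<gamma>s @ [\<gamma>]) = reflection_word \<delta>s"
      using Cons.IH Cons.prems(2) by blast
    then show ?thesis
      using Cons.prems(1) by (intro exI[of _ "\<epsilon> # \<delta>s"]) simp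
  next
    case True
    have \<epsilon>: "?w \<gamma> = \<epsilon>"
      using simple_reflection_positive[OF _ True, of \<epsilon>] Cons.prems(1,3) by auto
    have "root_reflection \<epsilon> (?w (root_reflection \<gamma> v)) = ?w v" for v
      using root_reflection_conjugate[OF orthogonal_reflection_word, of \<gamma>s \<gamma> "root_reflection \<gamma> v"] \<epsilon>
      by simp
    then show ?thesis
      using Cons.prems(1) by (intro exI[of _ \<gamma>s]) (simp add: fun_eq_iff)
  qed
qed

text \<open>
  This says that the Weyl group acts freely on chambers.  The last letter \<open>\<gamma>\<close> of such a word is sent
  to a negative root by the letters before it, so the exchange property replaces the word by a
  shorter one.
\<close>

lemma word_preserving_positive_roots:
  assumes "set \<gamma>s \<subseteq> S" "\<And>\<alpha>. \<alpha> \<in> Rp \<Longrightarrow> reflection_word \<gamma>s \<alpha> \<in> Rp"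
  shows "reflection_word \<gamma>s = id"
  using assms
proof (induction "length \<gamma>s" arbitrary: \<gamma>s rule: less_induct)
  case less
  show ?case
  proof (cases \<gamma>s rule: rev_cases)
    case Nil
    then show ?thesis by simp
  next
    case (snoc \<eta>s \<gamma>)
    then have \<gamma>: "\<gamma> \<in> S" and \<eta>s: "set \<eta>s \<subseteq> S" using less.prems(1) by auto
    have "- reflection_word \<eta>s \<gamma> \<in> Rp"
      using less.prems(2)[of \<gamma>] \<gamma> S_subset snoc by auto
    then have "reflection_word \<eta>s \<gamma> \<notin> Rp" using not_positive_and_negative by auto
    then obtain \<delta>s where \<delta>s: "set \<delta>s \<subseteq> S" "length \<delta>s < length \<eta>s"
      "reflection_word \<gamma>s = reflection_word \<delta>s"
      using exchange[OF \<eta>s \<gamma>] snoc by blast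
    have "reflection_word \<delta>s = id"
    proof (rule less.hyps)
      show "length \<delta>s < length \<gamma>s" using \<delta>s(2) snoc by simp
      show "reflection_word \<delta>s \<alpha> \<in> Rp" if "\<alpha> \<in> Rp" for \<alpha>
        using less.prems(2)[OF that] \<delta>s(3) by simp
    qed (rule \<delta>s(1))
    then show ?thesis using \<delta>s(3) by simp
  qed
qed

definition strictly_dominant :: "'a \<Rightarrow> bool" where
  "strictly_dominant x \<longleftrightarrow> (\<forall>\<alpha>\<in>Rp. x \<bullet> \<alpha> > 0)"

lemma strictly_dominant_iff: "strictly_dominant x \<Longrightarrow> \<alpha> \<in> R \<Longrightarrow> \<alpha> \<in> Rp \<longleftrightarrow> x \<bullet> \<alpha> > 0"
  using positive_or_negative[of \<alpha>] bspec[of Rp "\<lambda>\<alpha>. x \<bullet> \<alpha> > 0" \<alpha>] bspec[of Rp "\<lambda>\<alpha>. x \<bullet> \<alpha> > 0" "- \<alpha>"]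
  unfolding strictly_dominant_def by (auto simp: inner_minus_right)

lemma strictly_dominant_orbit_unique:
  assumes "strictly_dominant x" "strictly_dominant (reflection_word \<gamma>s x)" "set \<gamma>s \<subseteq> S"
  shows "reflection_word \<gamma>s x = x"
proof -
  have "reflection_word \<gamma>s = id"
  proof (rule word_preserving_positive_roots[OF assms(3)])
    fix \<alpha> assume \<alpha>: "\<alpha> \<in> Rp"
    then have "\<alpha> \<in> R" using Rp_subset by blast
    then have "reflection_word \<gamma>s \<alpha> \<in> R" by (rule simple_word_R[OF assms(3)])
    moreover have "reflection_word \<gamma>s x \<bullet> reflection_word \<gamma>s \<alpha> > 0"
      using assms(1) \<alpha> by (simp add: strictly_dominant_def)
    ultimately show "reflection_word \<gamma>s \<alpha> \<in> Rp"
      using strictly_dominant_iff[OF assms(2)] by blast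
  qed
  then show ?thesis by simp
qed

text \<open>
  Weyl's product with the shift by \<open>\<rho>\<close> removed, which makes it antisymmetric under the Weyl group.
\<close>

definition weyl_dim :: "'a \<Rightarrow> real" where
  "weyl_dim x = (\<Prod>\<alpha>\<in>Rp. (x \<bullet> coroot \<alpha>) / (rho Rp \<bullet> coroot \<alpha>))"

lemma irrep_dim_eq: "irrep_dim Rp v = weyl_dim (v + rho Rp)"
  by (simp add: irrep_dim_def weyl_dim_def)

lemma weyl_dim_eq_0_iff: "weyl_dim x = 0 \<longleftrightarrow> (\<exists>\<alpha>\<in>Rp. x \<bullet> \<alpha> = 0)"
proof -
  have "rho Rp \<bullet> coroot \<alpha> \<noteq> 0" if "\<alpha> \<in> Rp" for \<alpha>
    using rho_pos[OF that] by (simp add: inner_coroot_eq_0_iff)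
  then show ?thesis
    by (simp add: weyl_dim_def finite_Rp inner_coroot_eq_0_iff)
qed

lemma weyl_dim_simple_reflection:
  assumes "\<gamma> \<in> S"
  shows "weyl_dim (root_reflection \<gamma> x) = - weyl_dim x"
proof -
  have \<gamma>: "\<gamma> \<in> Rp" "\<gamma> \<noteq> 0" using assms S_subset S_in_R nonzero by auto
  have "(\<Prod>\<alpha>\<in>Rp - {\<gamma>}. root_reflection \<gamma> x \<bullet> coroot \<alpha>)
      = (\<Prod>\<alpha>\<in>Rp - {\<gamma>}. x \<bullet> coroot (root_reflection \<gamma> \<alpha>))"
    by (simp add: root_reflection_adjoint coroot_orthogonal[OF orthogonal_root_reflection])
  also have "\<dots> = (\<Prod>\<alpha>\<in>Rp - {\<gamma>}. x \<bullet> coroot \<alpha>)"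
    using prod.reindex_bij_betw[OF simple_reflection_bij[OF assms], of "\<lambda>\<alpha>. x \<bullet> coroot \<alpha>"] .
  finally have "(\<Prod>\<alpha>\<in>Rp. root_reflection \<gamma> x \<bullet> coroot \<alpha>) = - (\<Prod>\<alpha>\<in>Rp. x \<bullet> coroot \<alpha>)"
    using \<gamma> finite_Rp
    by (simp add: prod.remove[of Rp \<gamma>] root_reflection_adjoint[of \<gamma> x "coroot \<gamma>"]
        flip: coroot_orthogonal[OF orthogonal_root_reflection])
  then show ?thesis by (simp add: weyl_dim_def prod_dividef)
qed

definition num_negative :: "'a \<Rightarrow> nat" where
  "num_negative x = card {\<alpha>\<in>Rp. x \<bullet> \<alpha> < 0}"

lemma num_negative_simple_reflection:
  assumes "\<gamma> \<in> S" "x \<bullet> \<gamma> < 0"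
  shows "num_negative x = Suc (num_negative (root_reflection \<gamma> x))"
proof -
  let ?A = "{\<alpha>\<in>Rp - {\<gamma>}. x \<bullet> \<alpha> < 0}"
  have \<gamma>: "\<gamma> \<in> Rp" using assms S_subset by auto
  have "{\<alpha>\<in>Rp. x \<bullet> \<alpha> < 0} = insert \<gamma> ?A"
    using \<gamma> assms(2) by auto
  then have 1: "num_negative x = Suc (card ?A)"
    using finite_Rp by (simp add: num_negative_def)
  have "{\<alpha>\<in>Rp. root_reflection \<gamma> x \<bullet> \<alpha> < 0} = root_reflection \<gamma> ` ?A"
  proof (intro equalityI subsetI)
    fix \<alpha> assume "\<alpha> \<in> {\<alpha>\<in>Rp. root_reflection \<gamma> x \<bullet> \<alpha> < 0}"
    then have \<alpha>: "\<alpha> \<in> Rp" "root_reflection \<gamma> x \<bullet> \<alpha> < 0" by auto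
    have "\<alpha> \<noteq> \<gamma>" using \<alpha>(2) assms(2) by (auto simp: root_reflection_adjoint)
    then have "root_reflection \<gamma> \<alpha> \<in> Rp - {\<gamma>}"
      using simple_reflection_permutes[OF assms(1)] \<alpha>(1) by blast
    then have "root_reflection \<gamma> \<alpha> \<in> ?A" using \<alpha>(2) by (simp add: root_reflection_adjoint)
    then show "\<alpha> \<in> root_reflection \<gamma> ` ?A"
      by (rule rev_image_eqI) simp
  next
    fix \<alpha> assume "\<alpha> \<in> root_reflection \<gamma> ` ?A"
    then show "\<alpha> \<in> {\<alpha>\<in>Rp. root_reflection \<gamma> x \<bullet> \<alpha> < 0}"
      using simple_reflection_positive[OF assms(1)] by auto
  qed
  moreover have "inj_on (root_reflection \<gamma>) ?A"
    by (rule inj_on_inverseI[of _ "root_reflection \<gamma>"]) simp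
  ultimately have "num_negative (root_reflection \<gamma> x) = card ?A"
    by (simp add: num_negative_def card_image)
  with 1 show ?thesis by simp
qed

text \<open>
  Reflect in elements of \<open>I\<close> on which the vector is negative until none is left.  The number of
  negative positive roots drops by one each time, so the process ends, and this number also has the
  parity of the number of reflections.  A proper subset \<open>I\<close> of \<open>S\<close> serves to produce the longest
  element of \<open>W\<^sub>P\<close>.
\<close>

lemma move_to_dominant:
  assumes "I \<subseteq> S"
  shows "\<exists>\<gamma>s. set \<gamma>s \<subseteq> I \<and> (\<forall>\<gamma>\<in>I. reflection_word \<gamma>s x \<bullet> \<gamma> \<ge> 0) \<and>
    weyl_dim x = (- 1) ^ (num_negative x + num_negative (reflection_word \<gamma>s x))
      * weyl_dim (reflection_word \<gamma>s x)"
proof (induction "num_negative x" arbitrary: x rule: less_induct)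
  case less
  show ?case
  proof (cases "\<forall>\<gamma>\<in>I. x \<bullet> \<gamma> \<ge> 0")
    case True
    then show ?thesis by (intro exI[of _ "[]"]) (simp flip: mult_2)
  next
    case False
    then obtain \<gamma> where \<gamma>: "\<gamma> \<in> I" "\<gamma> \<in> S" "x \<bullet> \<gamma> < 0"
      using assms by (auto simp: not_le)
    let ?y = "root_reflection \<gamma> x"
    note Suc = num_negative_simple_reflection[OF \<gamma>(2,3)]
    then obtain \<gamma>s where \<gamma>s: "set \<gamma>s \<subseteq> I" "\<forall>\<gamma>\<in>I. reflection_word \<gamma>s ?y \<bullet> \<gamma> \<ge> 0"
      "weyl_dim ?y = (- 1) ^ (num_negative ?y + num_negative (reflection_word \<gamma>s ?y))
        * weyl_dim (reflection_word \<gamma>s ?y)"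
      using less[of ?y] by auto
    have "weyl_dim x = - weyl_dim ?y"
      using weyl_dim_simple_reflection[OF \<gamma>(2), of x] by simp
    then show ?thesis
      using \<gamma>s \<gamma>(1) Suc by (intro exI[of _ "\<gamma>s @ [\<gamma>]"]) simp
  qed
qed

lemma word_integral:
  assumes "set \<gamma>s \<subseteq> S" "\<And>\<gamma>. \<gamma> \<in> S \<Longrightarrow> x \<bullet> coroot \<gamma> \<in> \<int>" "\<gamma> \<in> S"
  shows "reflection_word \<gamma>s x \<bullet> coroot \<gamma> \<in> \<int>"
  using assms(1,3)
proof (induction \<gamma>s arbitrary: \<gamma>)
  case Nil
  then show ?case using assms(2) by simp
next
  case (Cons \<delta> \<gamma>s)
  have "reflection_word (\<delta> # \<gamma>s) x \<bullet> coroot \<gamma> = reflection_word \<gamma>s x \<bullet> coroot \<gamma>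
      - (reflection_word \<gamma>s x \<bullet> coroot \<delta>) * (\<delta> \<bullet> coroot \<gamma>)"
    by (simp add: root_reflection_def inner_diff_left)
  then show ?case
    using Cons cartan_integer S_in_R by (auto intro!: Ints_diff Ints_mult)
qed

section \<open>The index of a line bundle\<close>

text \<open>
  For integral \<open>y\<close>, positive pairings with simple coroots are at least \<open>1 = \<langle>\<rho>, \<gamma>\<^sup>\<or>\<rangle>\<close>.
\<close>

lemma dominant_iff_strictly_dominant:
  assumes "\<And>\<gamma>. \<gamma> \<in> S \<Longrightarrow> y \<bullet> coroot \<gamma> \<in> \<int>"
  shows "dominant Rp (y - rho Rp) \<longleftrightarrow> strictly_dominant y"
proof
  assume dom: "dominant Rp (y - rho Rp)"
  show "strictly_dominant y"
    unfolding strictly_dominant_def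
  proof
    fix \<alpha> assume \<alpha>: "\<alpha> \<in> Rp"
    show "y \<bullet> \<alpha> > 0"
    proof (rule strictly_dominant_pos[OF _ \<alpha>])
      fix \<gamma> assume "\<gamma> \<in> S"
      then have "y \<bullet> coroot \<gamma> \<ge> 1"
        using dom rho_coroot[of \<gamma>] by (auto simp: dominant_def inner_diff_left)
      then have "y \<bullet> coroot \<gamma> > 0" by linarith
      then show "y \<bullet> \<gamma> > 0" by (simp only: inner_coroot_pos_iff)
    qed
  qed
next
  assume sd: "strictly_dominant y"
  show "dominant Rp (y - rho Rp)"
    unfolding dominant_def
  proof
    fix \<gamma> assume \<gamma>: "\<gamma> \<in> S"
    then have "y \<bullet> \<gamma> > 0" using sd S_subset by (auto simp: strictly_dominant_def)
    then have "y \<bullet> coroot \<gamma> > 0" by (simp only: inner_coroot_pos_iff)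
    moreover obtain m where "y \<bullet> coroot \<gamma> = of_int m"
      using assms[OF \<gamma>] by (elim Ints_cases)
    ultimately have "y \<bullet> coroot \<gamma> \<ge> 1" by simp
    then show "(y - rho Rp) \<bullet> coroot \<gamma> \<ge> 0"
      using rho_coroot[OF \<gamma>] by (simp add: inner_diff_left)
  qed
qed

lemma weyl_length_eq_num_negative:
  assumes "set \<gamma>s \<subseteq> S" "strictly_dominant (reflection_word \<gamma>s x)"
  shows "weyl_length Rp (reflection_word \<gamma>s) = num_negative x"
proof -
  have "reflection_word \<gamma>s \<alpha> \<notin> Rp \<longleftrightarrow> x \<bullet> \<alpha> < 0" if \<alpha>: "\<alpha> \<in> Rp" for \<alpha>
  proof -
    have R: "reflection_word \<gamma>s \<alpha> \<in> R"
      using simple_word_R[OF assms(1)] \<alpha> Rp_subset by blast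
    have "reflection_word \<gamma>s \<alpha> \<in> Rp \<longleftrightarrow> x \<bullet> \<alpha> > 0"
      using strictly_dominant_iff[OF assms(2) R] by simp
    moreover have "- reflection_word \<gamma>s \<alpha> \<in> Rp \<longleftrightarrow> x \<bullet> \<alpha> < 0"
      using strictly_dominant_iff[OF assms(2) minus_in_R[OF R]] by simp
    ultimately show ?thesis
      using positive_or_negative[OF R] not_positive_and_negative by auto
  qed
  then show ?thesis
    unfolding weyl_length_def num_negative_def by (intro arg_cong[of _ _ card]) auto
qed

text \<open>
  If \<open>x = v + \<rho>\<close> is orthogonal to a root, then so are the points of its orbit to suitable roots, no
  cohomology occurs, and Weyl's product has a zero factor.  Otherwise there is exactly one highest
  weight, in degree \<open>n\<close>.  The sum reaches that degree: \<open>x\<close> is positive on the roots of the Levi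
  factor, so \<open>n\<close> counts roots outside it.
\<close>

lemma line_bundle_index_eq_weyl_dim:
  fixes Q :: "'a set" and v :: 'a
  defines "I \<equiv> parabolic_simple_roots Rp Q"
  assumes int: "\<And>\<gamma>. \<gamma> \<in> S \<Longrightarrow> v \<bullet> coroot \<gamma> \<in> \<int>"
    and zero: "\<And>\<gamma>. \<gamma> \<in> I \<Longrightarrow> v \<bullet> coroot \<gamma> = 0"
  shows "line_bundle_index R Rp Q v = weyl_dim (v + rho Rp)"
proof -
  define x where "x = v + rho Rp"
  define n where "n = num_negative x"
  have I: "I \<subseteq> S" by (auto simp: I_def parabolic_simple_roots_def)
  have x_int: "x \<bullet> coroot \<gamma> \<in> \<int>" if "\<gamma> \<in> S" for \<gamma>
    using int[OF that] rho_coroot[OF that] by (simp add: x_def inner_add_left)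
  have dom: "dominant Rp (reflection_word \<gamma>s x - rho Rp) \<longleftrightarrow> strictly_dominant (reflection_word \<gamma>s x)"
    if "set \<gamma>s \<subseteq> S" for \<gamma>s
    by (rule dominant_iff_strictly_dominant) (rule word_integral[OF that x_int])
  have weights: "cohomology_weights R Rp v i = {reflection_word \<gamma>s x - rho Rp | \<gamma>s.
      set \<gamma>s \<subseteq> S \<and> strictly_dominant (reflection_word \<gamma>s x) \<and> i = n}" for i
  proof (intro equalityI subsetI)
    fix \<mu> assume "\<mu> \<in> cohomology_weights R Rp v i"
    then obtain w where w: "dominant Rp \<mu>" "w \<in> weyl_group R" "weyl_length Rp w = i"
      "\<mu> = w x - rho Rp"
      unfolding cohomology_weights_def x_def by blast
    then obtain \<gamma>s where \<gamma>s: "set \<gamma>s \<subseteq> S" "w = reflection_word \<gamma>s"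
      using weyl_group_eq_simple_words by blast
    then have "strictly_dominant (reflection_word \<gamma>s x)" using dom w(1,4) by simp
    moreover from this have "i = n"
      using weyl_length_eq_num_negative[OF \<gamma>s(1)] w(3) \<gamma>s(2) by (simp add: n_def)
    ultimately show "\<mu> \<in> {reflection_word \<gamma>s x - rho Rp | \<gamma>s.
      set \<gamma>s \<subseteq> S \<and> strictly_dominant (reflection_word \<gamma>s x) \<and> i = n}"
      using w(4) \<gamma>s by blast
  next
    fix \<mu> assume "\<mu> \<in> {reflection_word \<gamma>s x - rho Rp | \<gamma>s.
      set \<gamma>s \<subseteq> S \<and> strictly_dominant (reflection_word \<gamma>s x) \<and> i = n}"
    then obtain \<gamma>s where \<gamma>s: "set \<gamma>s \<subseteq> S" "strictly_dominant (reflection_word \<gamma>s x)" "i = n"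
      "\<mu> = reflection_word \<gamma>s x - rho Rp" by blast
    have "reflection_word \<gamma>s \<in> weyl_group R"
      using \<gamma>s(1) weyl_group_eq_simple_words by blast
    moreover have "dominant Rp \<mu>" using dom \<gamma>s by simp
    moreover have "weyl_length Rp (reflection_word \<gamma>s) = i"
      using weyl_length_eq_num_negative[OF \<gamma>s(1,2)] \<gamma>s(3) by (simp add: n_def)
    ultimately show "\<mu> \<in> cohomology_weights R Rp v i"
      unfolding cohomology_weights_def using \<gamma>s(4) by (auto simp: x_def)
  qed
  show ?thesis
  proof (cases "weyl_dim x = 0")
    case True
    then obtain \<alpha> where \<alpha>: "\<alpha> \<in> Rp" "x \<bullet> \<alpha> = 0" by (auto simp: weyl_dim_eq_0_iff)
    have "\<not> strictly_dominant (reflection_word \<gamma>s x)" if "set \<gamma>s \<subseteq> S" for \<gamma>s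
    proof
      assume sd: "strictly_dominant (reflection_word \<gamma>s x)"
      have R: "reflection_word \<gamma>s \<alpha> \<in> R"
        using simple_word_R[OF that] \<alpha>(1) Rp_subset by blast
      show False
        using positive_or_negative[OF R] strictly_dominant_iff[OF sd R]
          strictly_dominant_iff[OF sd minus_in_R[OF R]] \<alpha>(2) by simp
    qed
    then have "cohomology_weights R Rp v i = {}" for i unfolding weights by blast
    then show ?thesis
      using True by (simp add: line_bundle_index_def cohomology_dim_def x_def)
  next
    case False
    obtain \<gamma>s where \<gamma>s: "set \<gamma>s \<subseteq> S" "\<forall>\<gamma>\<in>S. reflection_word \<gamma>s x \<bullet> \<gamma> \<ge> 0"
      "weyl_dim x = (- 1) ^ (n + num_negative (reflection_word \<gamma>s x))
        * weyl_dim (reflection_word \<gamma>s x)"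
      using move_to_dominant[of S x] unfolding n_def by auto
    let ?y = "reflection_word \<gamma>s x"
    have "weyl_dim ?y \<noteq> 0" using False \<gamma>s(3) by auto
    then have "?y \<bullet> \<gamma> > 0" if "\<gamma> \<in> S" for \<gamma>
      using \<gamma>s(2) that S_subset by (fastforce simp: weyl_dim_eq_0_iff less_le)
    then have sd: "strictly_dominant ?y"
      unfolding strictly_dominant_def using strictly_dominant_pos by blast
    then have "{\<alpha>\<in>Rp. ?y \<bullet> \<alpha> < 0} = {}"
      unfolding strictly_dominant_def using less_asym by blast
    then have "num_negative ?y = 0" by (simp only: num_negative_def card.empty)
    then have D: "weyl_dim x = (- 1) ^ n * weyl_dim ?y" using \<gamma>s(3) by simp
    \<comment> \<open>\<open>\<delta>s @ rev \<gamma>s\<close> carries \<open>?y\<close> to the other strictly dominant point.\<close>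
    have uniq: "reflection_word \<delta>s x = ?y"
      if \<delta>s: "set \<delta>s \<subseteq> S" "strictly_dominant (reflection_word \<delta>s x)" for \<delta>s
      using strictly_dominant_orbit_unique[OF sd, of "\<delta>s @ rev \<gamma>s"] \<delta>s \<gamma>s(1) by simp
    have "cohomology_weights R Rp v n = {?y - rho Rp}"
    proof (intro equalityI subsetI)
      fix \<mu> assume "\<mu> \<in> cohomology_weights R Rp v n"
      then obtain \<delta>s where "\<mu> = reflection_word \<delta>s x - rho Rp" "set \<delta>s \<subseteq> S"
        "strictly_dominant (reflection_word \<delta>s x)"
        unfolding weights by blast
      then show "\<mu> \<in> {?y - rho Rp}" using uniq by simp
    next
      fix \<mu> assume "\<mu> \<in> {?y - rho Rp}"
      then show "\<mu> \<in> cohomology_weights R Rp v n" unfolding weights using sd \<gamma>s(1) by blast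
    qed
    moreover have "cohomology_weights R Rp v i = {}" if "i \<noteq> n" for i
      unfolding weights using that by blast
    ultimately have "cohomology_weights R Rp v i = (if i = n then {?y - rho Rp} else {})" for i
      by simp
    then have dim: "cohomology_dim R Rp v i = (if i = n then weyl_dim ?y else 0)" for i
      by (simp add: cohomology_dim_def irrep_dim_eq)
    have "num_negative x \<le> card (Rp - parabolic_positive_roots Rp Q)"
      unfolding num_negative_def
    proof (intro card_mono subsetI)
      fix \<alpha> assume "\<alpha> \<in> {\<alpha>\<in>Rp. x \<bullet> \<alpha> < 0}"
      then have \<alpha>: "\<alpha> \<in> Rp" "x \<bullet> \<alpha> < 0" by auto
      have "\<alpha> \<notin> span I"
      proof
        assume "\<alpha> \<in> span I"
        then have span: "\<alpha> \<in> Rp \<inter> span I" using \<alpha>(1) by simp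
        have "x \<bullet> \<gamma> > 0" if "\<gamma> \<in> I" for \<gamma>
        proof -
          have "\<gamma> \<in> S" using that I by blast
          then have "x \<bullet> coroot \<gamma> > 0"
            using zero[OF that] rho_coroot[of \<gamma>] by (simp add: x_def inner_add_left)
          then show ?thesis by (simp only: inner_coroot_pos_iff)
        qed
        then have "x \<bullet> \<alpha> > 0" by (rule pos_on_positive_roots[OF _ I span])
        then show False using \<alpha>(2) by simp
      qed
      then show "\<alpha> \<in> Rp - parabolic_positive_roots Rp Q"
        using positive_roots_in_span[OF I] \<alpha>(1)
        unfolding parabolic_positive_roots_def I_def by blast
    qed (use finite_Rp in simp)
    then have "n \<le> card (Rp - parabolic_positive_roots Rp Q)" by (simp add: n_def)
    then have "line_bundle_index R Rp Q v = (- 1) ^ n * weyl_dim ?y"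
      unfolding line_bundle_index_def dim by (simp add: if_distrib[of "(*) _"] sum.delta cong: if_cong)
    then show ?thesis using D by (simp add: x_def)
  qed
qed

section \<open>Coroots of every height between \<open>1\<close> and \<open>n\<^sub>\<beta> - 1\<close>\<close>

text \<open>
  Root strings have no gaps.  The far end of the string is the reflection of \<open>\<delta>\<close>.  One step in from
  \<open>\<delta>\<^sup>\<or>\<close> leads to a coroot, because the angle is acute; subtracting \<open>\<gamma>\<^sup>\<or>\<close> lowers the pairing by \<open>2\<close>,
  so the string of that coroot is the one of \<open>\<delta>\<^sup>\<or>\<close> without its two ends.  The condition that \<open>\<delta>\<^sup>\<or>\<close>
  is no multiple of \<open>\<gamma>\<close> keeps the string away from \<open>0\<close>.
\<close>

lemma coroot_string:
  assumes "\<delta> \<in> R" "\<gamma> \<in> R" "\<And>c. coroot \<delta> \<noteq> c *\<^sub>R \<gamma>" "\<gamma> \<bullet> coroot \<delta> = real m" "i \<le> m"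
  shows "\<exists>\<alpha>\<in>R. coroot \<alpha> = coroot \<delta> - real i *\<^sub>R coroot \<gamma>"
  using assms
proof (induction m arbitrary: \<delta> i rule: less_induct)
  case (less m)
  consider "i = 0" | "i = m" | "1 \<le> i" "i < m" using less.prems(5) by linarith
  then show ?case
  proof cases
    case 1
    then show ?thesis using less.prems(1) by (intro bexI[of _ \<delta>]) simp_all
  next
    case 2
    have "coroot (root_reflection \<gamma> \<delta>) = coroot \<delta> - real i *\<^sub>R coroot \<gamma>"
      using less.prems(4) 2 by (simp add: coroot_reflection)
    then show ?thesis using reflection_R[OF less.prems(2,1)] by (rule bexI)
  next
    case 3
    have "\<delta> \<noteq> \<gamma>"
    proof
      assume "\<delta> = \<gamma>"
      then have "coroot \<delta> = (2 / (\<gamma> \<bullet> \<gamma>)) *\<^sub>R \<gamma>" by (simp add: coroot_def)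
      then show False using less.prems(3) by blast
    qed
    moreover have "\<gamma> \<bullet> coroot \<delta> > 0" using less.prems(4) 3 by simp
    then have "\<delta> \<bullet> \<gamma> > 0" by (simp only: inner_coroot_pos_iff inner_commute)
    ultimately obtain \<epsilon> where \<epsilon>: "\<epsilon> \<in> R" "coroot \<epsilon> = coroot \<delta> - coroot \<gamma>"
      using difference_coroot less.prems(1,2) by blast
    have "\<exists>\<alpha>\<in>R. coroot \<alpha> = coroot \<epsilon> - real (i - 1) *\<^sub>R coroot \<gamma>"
    proof (rule less.IH[of "m - 2"])
      show "coroot \<epsilon> \<noteq> c *\<^sub>R \<gamma>" for c
      proof
        assume "coroot \<epsilon> = c *\<^sub>R \<gamma>"
        then have "coroot \<delta> = (c + 2 / (\<gamma> \<bullet> \<gamma>)) *\<^sub>R \<gamma>"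
          using \<epsilon>(2) by (simp add: coroot_def scaleR_left_distrib algebra_simps)
        then show False using less.prems(3) by blast
      qed
      show "\<gamma> \<bullet> coroot \<epsilon> = real (m - 2)"
        using 3 less.prems(4) inner_coroot_self[OF nonzero[OF less.prems(2)]]
        by (simp add: \<epsilon>(2) inner_diff_right)
    qed (use 3 \<epsilon>(1) less.prems(2) in simp_all)
    moreover have "coroot \<epsilon> - real (i - 1) *\<^sub>R coroot \<gamma> = coroot \<delta> - real i *\<^sub>R coroot \<gamma>"
      using 3 by (simp add: \<epsilon>(2) of_nat_diff scaleR_left_diff_distrib)
    ultimately show ?thesis by simp
  qed
qed

lemma coroot_in_span: "\<gamma> \<in> I \<Longrightarrow> coroot \<gamma> \<in> span I"
  by (simp add: coroot_def span_scale span_base)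

lemma simple_coroot_notin_span:
  assumes "\<beta> \<in> S - I" "I \<subseteq> S"
  shows "coroot \<beta> \<notin> span I"
proof
  assume "coroot \<beta> \<in> span I"
  then have "(\<beta> \<bullet> \<beta> / 2) *\<^sub>R coroot \<beta> \<in> span I" by (rule span_scale)
  moreover have "\<beta> \<noteq> 0" using assms(1) S_in_R nonzero by simp
  then have "(\<beta> \<bullet> \<beta> / 2) *\<^sub>R coroot \<beta> = \<beta>" by (simp add: coroot_def)
  ultimately show False using simple_notin_span[OF assms] by simp
qed

lemma coroot_word: "coroot (reflection_word \<gamma>s \<delta>) = reflection_word \<gamma>s (coroot \<delta>)"
  by (rule coroot_orthogonal[OF orthogonal_reflection_word])

text \<open>
  Induction along the word.  If a letter \<open>\<gamma>\<close> raises the height of the coroot, the new heights are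
  those of the string in the direction of \<open>\<gamma>\<^sup>\<or>\<close> that joins the old coroot to the new one.  The
  integrality of the height is carried along so that natural numbers fit the string.
\<close>

lemma coroots_of_all_smaller_heights:
  assumes I: "I \<subseteq> S" and \<beta>: "\<beta> \<in> S - I" and "set \<gamma>s \<subseteq> I"
  shows "rho Rp \<bullet> coroot (reflection_word \<gamma>s \<beta>) \<in> \<int> \<and>
    (\<forall>j\<ge>1. real j \<le> rho Rp \<bullet> coroot (reflection_word \<gamma>s \<beta>) \<longrightarrow>
      (\<exists>\<alpha>\<in>R. coroot \<alpha> - coroot \<beta> \<in> span I \<and> rho Rp \<bullet> coroot \<alpha> = real j))"
  using assms(3)
proof (induction \<gamma>s)
  case Nil
  have \<beta>R: "\<beta> \<in> R" "rho Rp \<bullet> coroot \<beta> = 1" using \<beta> S_in_R rho_coroot by auto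
  show ?case
  proof (intro conjI allI impI)
    show "rho Rp \<bullet> coroot (reflection_word [] \<beta>) \<in> \<int>" using \<beta>R(2) by simp
    fix j :: nat assume "1 \<le> j" "real j \<le> rho Rp \<bullet> coroot (reflection_word [] \<beta>)"
    then have "j = 1" using \<beta>R(2) by simp
    then show "\<exists>\<alpha>\<in>R. coroot \<alpha> - coroot \<beta> \<in> span I \<and> rho Rp \<bullet> coroot \<alpha> = real j"
      using \<beta>R by (intro bexI[of _ \<beta>]) (simp_all add: span_zero)
  qed
next
  case (Cons \<gamma> \<gamma>s)
  define \<delta> where "\<delta> = reflection_word \<gamma>s \<beta>"
  define \<epsilon> where "\<epsilon> = root_reflection \<gamma> \<delta>"
  have \<gamma>: "\<gamma> \<in> I" "\<gamma> \<in> S" "\<gamma> \<in> R" using Cons.prems I S_in_R by auto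
  have "set \<gamma>s \<subseteq> S" using Cons.prems I by auto
  then have \<delta>R: "\<delta> \<in> R" unfolding \<delta>_def using simple_word_R \<beta> S_in_R by simp
  have \<epsilon>R: "\<epsilon> \<in> R" unfolding \<epsilon>_def using reflection_R \<gamma>(3) \<delta>R by simp
  have IH: "rho Rp \<bullet> coroot \<delta> \<in> \<int>"
    "\<And>j. 1 \<le> j \<Longrightarrow> real j \<le> rho Rp \<bullet> coroot \<delta> \<Longrightarrow>
      \<exists>\<alpha>\<in>R. coroot \<alpha> - coroot \<beta> \<in> span I \<and> rho Rp \<bullet> coroot \<alpha> = real j"
    using Cons unfolding \<delta>_def by auto
  obtain p where p: "\<gamma> \<bullet> coroot \<delta> = of_int p"
    using cartan_integer[OF \<gamma>(3) \<delta>R] by (elim Ints_cases)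
  obtain h where h: "rho Rp \<bullet> coroot \<delta> = of_int h" using IH(1) by (elim Ints_cases)
  have c\<epsilon>: "coroot \<epsilon> = coroot \<delta> - of_int p *\<^sub>R coroot \<gamma>"
    using p by (simp add: \<epsilon>_def coroot_reflection)
  have h\<epsilon>: "rho Rp \<bullet> coroot \<epsilon> = of_int (h - p)"
    using h rho_coroot[OF \<gamma>(2)] by (simp add: c\<epsilon> inner_diff_right)
  have p\<epsilon>: "\<gamma> \<bullet> coroot \<epsilon> = of_int (- p)"
    using p inner_coroot_self[OF nonzero[OF \<gamma>(3)]] by (simp add: c\<epsilon> inner_diff_right)
  have word: "reflection_word (\<gamma> # \<gamma>s) \<beta> = \<epsilon>" by (simp add: \<epsilon>_def \<delta>_def)
  have span: "coroot \<epsilon> - coroot \<beta> \<in> span I"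
    using reflection_word_in_span[OF Cons.prems, of "coroot \<beta>"]
    unfolding word[symmetric] coroot_word .
  have notmult: "coroot \<epsilon> \<noteq> c *\<^sub>R \<gamma>" for c
  proof
    assume "coroot \<epsilon> = c *\<^sub>R \<gamma>"
    then have "coroot \<epsilon> \<in> span I" using \<gamma>(1) by (simp add: span_scale span_base)
    then have "coroot \<epsilon> - (coroot \<epsilon> - coroot \<beta>) \<in> span I" using span by (rule span_diff)
    then show False using simple_coroot_notin_span[OF \<beta> I] by simp
  qed
  show ?case
    unfolding word
  proof (intro conjI allI impI)
    show "rho Rp \<bullet> coroot \<epsilon> \<in> \<int>" using h\<epsilon> by simp
    fix j :: nat assume j: "1 \<le> j" "real j \<le> rho Rp \<bullet> coroot \<epsilon>"
    show "\<exists>\<alpha>\<in>R. coroot \<alpha> - coroot \<beta> \<in> span I \<and> rho Rp \<bullet> coroot \<alpha> = real j"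
    proof (cases "int j \<le> h")
      case True
      then show ?thesis using IH(2)[OF j(1)] h by simp
    next
      case False
      have jh: "int j \<le> h - p" using j(2) unfolding h\<epsilon> by linarith
      \<comment> \<open>The number of steps down from \<open>coroot \<epsilon>\<close>, of height \<open>h - p\<close>, to height \<open>j\<close>.\<close>
      define i where "i = nat (h - p - int j)"
      have i: "i \<le> nat (- p)" "real i = of_int (h - p - int j)"
        using False jh by (simp_all add: i_def)
      have "\<gamma> \<bullet> coroot \<epsilon> = real (nat (- p))" using False jh p\<epsilon> by simp
      then obtain \<alpha> where \<alpha>: "\<alpha> \<in> R" "coroot \<alpha> = coroot \<epsilon> - real i *\<^sub>R coroot \<gamma>"
        using coroot_string[OF \<epsilon>R \<gamma>(3) notmult _ i(1)] by blast
      have "coroot \<alpha> - coroot \<beta> = (coroot \<epsilon> - coroot \<beta>) - real i *\<^sub>R coroot \<gamma>"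
        by (simp add: \<alpha>(2))
      also have "\<dots> \<in> span I"
        by (intro span_diff span span_scale coroot_in_span \<gamma>(1))
      finally have "coroot \<alpha> - coroot \<beta> \<in> span I" .
      moreover have "rho Rp \<bullet> coroot \<alpha> = real j"
        using h\<epsilon> rho_coroot[OF \<gamma>(2)] by (simp add: \<alpha>(2) inner_diff_right i(2))
      ultimately show ?thesis using \<alpha>(1) by blast
    qed
  qed
qed

text \<open>
  The longest element of the group generated by the reflections in \<open>I\<close>, obtained by moving \<open>-\<rho>\<close> to
  the dominant chamber of \<open>I\<close>.  As \<open>\<rho>\<close> is orthogonal to no root, \<open>-w \<rho>\<close> is strictly positive
  on the roots \<open>\<alpha>\<close> in question, so \<open>\<rho>\<close> is positive on \<open>-w\<^sup>-\<^sup>1 \<alpha>\<close>, which is therefore a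
  positive root, again in the span of \<open>I\<close>.  Hence \<open>\<alpha> \<mapsto> -w\<^sup>-\<^sup>1 \<alpha>\<close> permutes these roots.
\<close>

lemma word_negating_positive_roots:
  assumes I: "I \<subseteq> S"
  shows "\<exists>\<gamma>s. set \<gamma>s \<subseteq> I \<and> reflection_word \<gamma>s (\<Sum>(Rp \<inter> span I)) = - \<Sum>(Rp \<inter> span I)"
proof -
  let ?A = "Rp \<inter> span I"
  obtain \<gamma>s where \<gamma>s: "set \<gamma>s \<subseteq> I" "\<forall>\<gamma>\<in>I. reflection_word \<gamma>s (- rho Rp) \<bullet> \<gamma> \<ge> 0"
    using move_to_dominant[OF I, of "- rho Rp"] by blast
  define f where "f \<alpha> = - reflection_word (rev \<gamma>s) \<alpha>" for \<alpha>
  have eq: "reflection_word \<gamma>s (- rho Rp) \<bullet> \<alpha> = rho Rp \<bullet> f \<alpha>" for \<alpha>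
    by (simp add: f_def reflection_word_adjoint)
  have fR: "f \<alpha> \<in> R" if "\<alpha> \<in> R" for \<alpha>
    unfolding f_def using minus_in_R simple_word_R[of "rev \<gamma>s"] that \<gamma>s(1) I by auto
  have pos_iff: "f \<alpha> \<in> Rp \<longleftrightarrow> rho Rp \<bullet> f \<alpha> > 0" if "\<alpha> \<in> R" for \<alpha>
    using strictly_dominant_iff[OF _ fR[OF that]] rho_pos by (simp add: strictly_dominant_def)
  have neq: "rho Rp \<bullet> \<alpha> \<noteq> 0" if "\<alpha> \<in> R" for \<alpha>
    using positive_or_negative[OF that] rho_pos[of \<alpha>] rho_pos[of "- \<alpha>"] by auto
  have fA: "f ` ?A \<subseteq> ?A"
  proof
    fix x assume "x \<in> f ` ?A"
    then obtain \<alpha> where \<alpha>: "\<alpha> \<in> ?A" "x = f \<alpha>" by blast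
    have \<alpha>R: "\<alpha> \<in> R" using \<alpha>(1) Rp_subset by blast
    have "reflection_word \<gamma>s (- rho Rp) \<bullet> \<alpha> > 0"
    proof (rule pos_on_positive_roots[OF _ I \<alpha>(1)])
      fix \<gamma> assume \<gamma>: "\<gamma> \<in> I"
      then have "\<gamma> \<in> R" using I S_in_R by blast
      then have "rho Rp \<bullet> f \<gamma> \<noteq> 0" by (rule neq[OF fR])
      moreover have "rho Rp \<bullet> f \<gamma> \<ge> 0" using bspec[OF \<gamma>s(2) \<gamma>] unfolding eq .
      ultimately show "reflection_word \<gamma>s (- rho Rp) \<bullet> \<gamma> > 0" unfolding eq by simp
    qed
    then have "f \<alpha> \<in> Rp" using pos_iff[OF \<alpha>R] by (simp only: eq)
    moreover have "reflection_word (rev \<gamma>s) \<alpha> - \<alpha> \<in> span I"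
      using reflection_word_in_span[of "rev \<gamma>s" I \<alpha>] \<gamma>s(1) by simp
    then have "reflection_word (rev \<gamma>s) \<alpha> - \<alpha> + \<alpha> \<in> span I"
      using \<alpha>(1) by (intro span_add) simp_all
    then have "f \<alpha> \<in> span I" unfolding f_def by (simp add: span_neg)
    ultimately show "x \<in> ?A" using \<alpha>(2) by simp
  qed
  have inj: "inj_on f ?A"
    by (rule inj_on_inverseI[of _ "\<lambda>\<alpha>. - reflection_word \<gamma>s \<alpha>"]) (simp add: f_def)
  have "f ` ?A = ?A" using endo_inj_surj[OF _ fA inj] finite_Rp by simp
  then have "\<Sum>?A = (\<Sum>\<alpha>\<in>?A. f \<alpha>)"
    using sum.reindex[OF inj, of "\<lambda>x. x"] by simp
  also have "\<dots> = - reflection_word (rev \<gamma>s) (\<Sum>?A)"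
    by (simp add: f_def sum_negf linear_sum[OF linear_reflection_word])
  finally have "reflection_word \<gamma>s (\<Sum>?A) = reflection_word \<gamma>s (- reflection_word (rev \<gamma>s) (\<Sum>?A))"
    by (rule arg_cong)
  then have "reflection_word \<gamma>s (\<Sum>?A) = - \<Sum>?A" by simp
  then show ?thesis using \<gamma>s(1) by blast
qed

lemma inner_span_eq_0:
  assumes "\<And>\<gamma>. \<gamma> \<in> I \<Longrightarrow> v \<bullet> coroot \<gamma> = 0" "y \<in> span I"
  shows "v \<bullet> y = 0"
  using assms(2)
proof (induction rule: span_induct_alt)
  case (step c \<gamma> y)
  then show ?case using assms(1)[of \<gamma>] by (simp add: inner_add_right inner_coroot_eq_0_iff)
qed simp

text \<open>
  Let \<open>r\<close> be half the sum of the positive roots in the span of \<open>I\<close>.  It agrees with \<open>\<rho>\<close> on that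
  span, and \<open>n\<^sub>\<beta> = \<langle>2\<rho> - 2r, \<beta>\<^sup>\<or>\<rangle> = 2 - 2\<langle>r, \<beta>\<^sup>\<or>\<rangle>\<close>.  If \<open>w r = -r\<close>, the height of \<open>w \<beta>\<^sup>\<or>\<close>
  exceeds that of \<open>\<beta>\<^sup>\<or>\<close>, which is \<open>1\<close>, by
  \<open>\<langle>r, w \<beta>\<^sup>\<or> - \<beta>\<^sup>\<or>\<rangle> = -2\<langle>r, \<beta>\<^sup>\<or>\<rangle> = n\<^sub>\<beta> - 2\<close>.
\<close>

lemma coroot_of_height_chern_coeff:
  fixes Q :: "'a set"
  defines "I \<equiv> parabolic_simple_roots Rp Q"
  assumes \<beta>: "\<beta> \<in> S - I"
  shows "\<exists>\<gamma>s. set \<gamma>s \<subseteq> I \<and> rho Rp \<bullet> coroot (reflection_word \<gamma>s \<beta>) = chern_coeff Rp Q \<beta> - 1"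
proof -
  let ?A = "Rp \<inter> span I"
  have I: "I \<subseteq> S" by (auto simp: I_def parabolic_simple_roots_def)
  have A: "parabolic_positive_roots Rp Q = ?A"
    unfolding parabolic_positive_roots_def I_def
    by (rule positive_roots_in_span) (auto simp: parabolic_simple_roots_def)
  define r where "r = (1 / 2) *\<^sub>R \<Sum>?A"
  have r_coroot: "r \<bullet> coroot \<gamma> = 1" if \<gamma>: "\<gamma> \<in> I" for \<gamma>
  proof -
    have \<gamma>S: "\<gamma> \<in> S" using \<gamma> I by blast
    have "root_reflection \<gamma> ` (?A - {\<gamma>}) \<subseteq> ?A - {\<gamma>}"
    proof
      fix x assume "x \<in> root_reflection \<gamma> ` (?A - {\<gamma>})"
      then obtain \<alpha> where \<alpha>: "\<alpha> \<in> Rp - {\<gamma>}" "\<alpha> \<in> span I" "x = root_reflection \<gamma> \<alpha>" by blast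
      have "x \<in> Rp - {\<gamma>}" using simple_reflection_permutes[OF \<gamma>S] \<alpha>(1,3) by blast
      moreover have "x \<in> span I"
        unfolding \<alpha>(3) root_reflection_def using \<alpha>(2) span_base[OF \<gamma>] by (intro span_diff span_scale)
      ultimately show "x \<in> ?A - {\<gamma>}" by blast
    qed
    moreover have "\<gamma> \<in> ?A" using \<gamma> \<gamma>S S_subset span_base by blast
    moreover have "\<gamma> \<noteq> 0" using nonzero S_in_R[OF \<gamma>S] by blast
    moreover have "finite ?A" using finite_Rp by blast
    ultimately have "\<Sum>?A \<bullet> coroot \<gamma> = 2" using sum_inner_coroot by blast
    then show ?thesis by (simp add: r_def)
  qed
  have same: "rho Rp \<bullet> y = r \<bullet> y" if "y \<in> span I" for y
  proof -
    have "(rho Rp - r) \<bullet> y = 0"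
    proof (rule inner_span_eq_0[OF _ that])
      fix \<gamma> assume "\<gamma> \<in> I"
      then show "(rho Rp - r) \<bullet> coroot \<gamma> = 0"
        using r_coroot rho_coroot I by (simp add: inner_diff_left subset_iff)
    qed
    then show ?thesis by (simp add: inner_diff_left)
  qed
  obtain \<gamma>s where \<gamma>s: "set \<gamma>s \<subseteq> I" "reflection_word \<gamma>s (\<Sum>?A) = - \<Sum>?A"
    using word_negating_positive_roots[OF I] by blast
  let ?w = "reflection_word \<gamma>s"
  have wr: "?w r = - r"
    using \<gamma>s(2) by (simp add: r_def linear_scale[OF linear_reflection_word])
  have "chern_coeff Rp Q \<beta> = \<Sum>(Rp - ?A) \<bullet> coroot \<beta>"
    by (simp add: chern_coeff_def A inner_sum_left)
  also have "\<Sum>(Rp - ?A) = 2 *\<^sub>R rho Rp - 2 *\<^sub>R r"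
    using finite_Rp by (subst sum_diff) (simp_all add: rho_def r_def)
  finally have chern: "chern_coeff Rp Q \<beta> = 2 - 2 * (r \<bullet> coroot \<beta>)"
    using rho_coroot[of \<beta>] \<beta> by (simp add: inner_diff_left)
  have "rho Rp \<bullet> ?w (coroot \<beta>) = rho Rp \<bullet> coroot \<beta> + rho Rp \<bullet> (?w (coroot \<beta>) - coroot \<beta>)"
    by (simp add: inner_diff_right)
  also have "\<dots> = 1 + r \<bullet> (?w (coroot \<beta>) - coroot \<beta>)"
    using same[OF reflection_word_in_span[OF \<gamma>s(1)]] rho_coroot[of \<beta>] \<beta> by simp
  also have "r \<bullet> ?w (coroot \<beta>) = - (?w r \<bullet> ?w (coroot \<beta>))"
    unfolding wr by simp
  then have "r \<bullet> ?w (coroot \<beta>) = - (r \<bullet> coroot \<beta>)" by simp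
  then have "1 + r \<bullet> (?w (coroot \<beta>) - coroot \<beta>) = chern_coeff Rp Q \<beta> - 1"
    using chern by (simp add: inner_diff_right)
  finally show ?thesis using \<gamma>s(1) by (intro exI[of _ \<gamma>s]) (simp add: coroot_word)
qed

lemma weyl_dim_vanishes:
  fixes Q :: "'a set"
  defines "I \<equiv> parabolic_simple_roots Rp Q"
  assumes \<beta>: "\<beta> \<in> S - I" and j: "1 \<le> j" "real j \<le> chern_coeff Rp Q \<beta> - 1"
    and zero: "\<And>\<gamma>. \<gamma> \<in> I \<Longrightarrow> v \<bullet> coroot \<gamma> = 0" and v\<beta>: "v \<bullet> coroot \<beta> = - real j"
  shows "weyl_dim (v + rho Rp) = 0"
proof -
  have I: "I \<subseteq> S" by (auto simp: I_def parabolic_simple_roots_def)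
  obtain \<gamma>s where \<gamma>s: "set \<gamma>s \<subseteq> I"
    "rho Rp \<bullet> coroot (reflection_word \<gamma>s \<beta>) = chern_coeff Rp Q \<beta> - 1"
    using coroot_of_height_chern_coeff \<beta> unfolding I_def by blast
  obtain \<alpha> where \<alpha>: "\<alpha> \<in> R" "coroot \<alpha> - coroot \<beta> \<in> span I" "rho Rp \<bullet> coroot \<alpha> = real j"
    using coroots_of_all_smaller_heights[OF I \<beta> \<gamma>s(1)] j unfolding \<gamma>s(2) by blast
  have "v \<bullet> (coroot \<alpha> - coroot \<beta>) = 0" by (rule inner_span_eq_0[OF zero \<alpha>(2)])
  then have "(v + rho Rp) \<bullet> coroot \<alpha> = 0"
    using v\<beta> \<alpha>(3) by (simp add: inner_add_left inner_diff_right)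
  then have "(v + rho Rp) \<bullet> \<alpha> = 0" by (simp only: inner_coroot_eq_0_iff)
  moreover from this have "(v + rho Rp) \<bullet> - \<alpha> = 0" by simp
  ultimately show ?thesis
    using positive_or_negative[OF \<alpha>(1)] unfolding weyl_dim_eq_0_iff by blast
qed

section \<open>The Hilbert polynomial\<close>

text \<open>
  The simple coroots form a basis, so the dual basis exists and is unique; the vector \<open>v\<close> represents
  the corresponding linear functional.
\<close>

lemma fundamental_weight_coroot:
  assumes "\<gamma> \<in> S" "\<delta> \<in> S"
  shows "fundamental_weight Rp \<gamma> \<bullet> coroot \<delta> = (if \<delta> = \<gamma> then 1 else 0)"
proof -
  let ?P = "\<lambda>v. \<forall>\<delta>\<in>S. v \<bullet> coroot \<delta> = (if \<delta> = \<gamma> then 1 else 0)"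
  obtain g where g: "linear g" "\<forall>\<delta>\<in>S. g \<delta> = (if \<delta> = \<gamma> then \<delta> \<bullet> \<delta> / 2 else 0)"
    using linear_independent_extend[OF independent_S, of "\<lambda>\<delta>. if \<delta> = \<gamma> then \<delta> \<bullet> \<delta> / 2 else 0"]
    by blast
  define v where "v = (\<Sum>b\<in>Basis. g b *\<^sub>R b)"
  have v: "v \<bullet> x = g x" for x
  proof -
    have "g x = g (\<Sum>b\<in>Basis. (x \<bullet> b) *\<^sub>R b)" by (simp add: euclidean_representation)
    also have "\<dots> = (\<Sum>b\<in>Basis. (x \<bullet> b) * g b)"
      by (simp add: linear_sum[OF g(1)] linear_scale[OF g(1)])
    finally show ?thesis
      unfolding v_def inner_sum_left by (simp add: inner_commute mult.commute)
  qed
  have "?P v"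
  proof
    fix \<delta> assume \<delta>: "\<delta> \<in> S"
    then have "\<delta> \<noteq> 0" using S_in_R nonzero by simp
    then show "v \<bullet> coroot \<delta> = (if \<delta> = \<gamma> then 1 else 0)"
      using g(2) \<delta> by (simp add: v coroot_def linear_scale[OF g(1)])
  qed
  moreover have "u = v" if u: "?P u" for u
  proof -
    have "(u - v) \<bullet> coroot \<delta> = 0" if "\<delta> \<in> S" for \<delta>
      using u \<open>?P v\<close> that by (simp add: inner_diff_left)
    moreover have "u - v \<in> span S" unfolding span_S by (rule UNIV_I)
    ultimately have "(u - v) \<bullet> (u - v) = 0" by (rule inner_span_eq_0)
    then show ?thesis by simp
  qed
  ultimately have "\<exists>!v. ?P v" by (rule ex1I)
  then have "?P (fundamental_weight Rp \<gamma>)" unfolding fundamental_weight_def by (rule theI')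
  then show ?thesis using assms(2) by blast
qed

lemma weight_coroot:
  assumes "J \<subseteq> S" "\<delta> \<in> S"
  shows "(\<Sum>\<gamma>\<in>J. k \<gamma> *\<^sub>R fundamental_weight Rp \<gamma>) \<bullet> coroot \<delta> = (if \<delta> \<in> J then k \<delta> else 0)"
proof -
  have fin: "finite J" using assms(1) finite_S finite_subset by blast
  have "(\<Sum>\<gamma>\<in>J. k \<gamma> *\<^sub>R fundamental_weight Rp \<gamma>) \<bullet> coroot \<delta>
      = (\<Sum>\<gamma>\<in>J. if \<gamma> = \<delta> then k \<gamma> else 0)"
    unfolding inner_sum_left
    using assms by (intro sum.cong) (auto simp: fundamental_weight_coroot)
  also have "\<dots> = (if \<delta> \<in> J then k \<delta> else 0)" using fin by simp
  finally show ?thesis .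
qed

lemma polynomial_weyl_dim:
  "polynomial_function J (\<lambda>k. weyl_dim ((\<Sum>\<gamma>\<in>J. k \<gamma> *\<^sub>R fundamental_weight Rp \<gamma>) + rho Rp))"
proof -
  have "weyl_dim ((\<Sum>\<gamma>\<in>J. k \<gamma> *\<^sub>R fundamental_weight Rp \<gamma>) + rho Rp)
      = (\<Prod>\<alpha>\<in>Rp. ((\<Sum>\<gamma>\<in>J. k \<gamma> * (fundamental_weight Rp \<gamma> \<bullet> coroot \<alpha>)) + rho Rp \<bullet> coroot \<alpha>)
          * (1 / (rho Rp \<bullet> coroot \<alpha>)))" for k
    by (simp add: weyl_dim_def inner_add_left inner_sum_left)
  then show ?thesis
    by (simp only:) (intro polynomial_function_prod polynomial_function_mult
        polynomial_function_add polynomial_function_sum polynomial_function_const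
        polynomial_function_var)
qed

lemma hilbert_polynomial_eval:
  fixes Q :: "'a set" and k :: "'a \<Rightarrow> int"
  defines "J \<equiv> S - parabolic_simple_roots Rp Q"
  shows "mpoly_eval (\<lambda>\<gamma>. of_int (k \<gamma>)) (hilbert_polynomial R Rp Q) =
    weyl_dim ((\<Sum>\<gamma>\<in>J. of_int (k \<gamma>) *\<^sub>R fundamental_weight Rp \<gamma>) + rho Rp)"
proof -
  let ?v = "\<lambda>k. \<Sum>\<gamma>\<in>J. k \<gamma> *\<^sub>R fundamental_weight Rp \<gamma>"
  let ?P = "\<lambda>p. mpoly_vars p \<subseteq> J \<and> (\<forall>k :: 'a \<Rightarrow> int.
    mpoly_eval (\<lambda>\<gamma>. of_int (k \<gamma>)) p = line_bundle_index R Rp Q (?v (\<lambda>\<gamma>. of_int (k \<gamma>))))"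
  have J: "J \<subseteq> S" by (auto simp: J_def)
  have index: "line_bundle_index R Rp Q (?v (\<lambda>\<gamma>. of_int (k \<gamma>)))
      = weyl_dim (?v (\<lambda>\<gamma>. of_int (k \<gamma>)) + rho Rp)" for k :: "'a \<Rightarrow> int"
  proof (rule line_bundle_index_eq_weyl_dim)
    fix \<gamma> assume "\<gamma> \<in> S"
    then show "?v (\<lambda>\<gamma>. of_int (k \<gamma>)) \<bullet> coroot \<gamma> \<in> \<int>" by (simp add: weight_coroot[OF J])
  next
    fix \<gamma> assume \<gamma>: "\<gamma> \<in> parabolic_simple_roots Rp Q"
    then have "\<gamma> \<in> S" "\<gamma> \<notin> J" by (auto simp: J_def parabolic_simple_roots_def)
    then show "?v (\<lambda>\<gamma>. of_int (k \<gamma>)) \<bullet> coroot \<gamma> = 0" by (simp add: weight_coroot[OF J])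
  qed
  obtain p where p: "mpoly_vars p \<subseteq> J" "\<And>k. mpoly_eval k p = weyl_dim (?v k + rho Rp)"
    using polynomial_weyl_dim[of J] unfolding polynomial_function_def by blast
  have "?P p" using p index by simp
  moreover have "q = p" if "?P q" for q
    by (rule mpoly_eqI) (use that \<open>?P p\<close> in simp)
  ultimately have "\<exists>!p. ?P p" by (rule ex1I)
  then have "?P (hilbert_polynomial R Rp Q)"
    unfolding hilbert_polynomial_def J_def by (rule theI')
  then show ?thesis using index by simp
qed

end

theorem theorem3p6:
  fixes R Rp Q :: "'a::euclidean_space set" and \<beta> :: 'a and j :: nat
  assumes "root_system R" and "positive_system R Rp" and "parabolic_roots R Rp Q"
    and "\<beta> \<in> simple_roots Rp - parabolic_simple_roots Rp Q"
    and "1 \<le> j" and "real j \<le> chern_coeff Rp Q \<beta> - 1"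
  shows "mpoly_subst \<beta> (- real j) (hilbert_polynomial R Rp Q) = 0"
proof -
  obtain \<xi> where "\<And>\<alpha>. \<alpha> \<in> R \<Longrightarrow> \<xi> \<bullet> \<alpha> \<noteq> 0" "Rp = {\<alpha>\<in>R. \<xi> \<bullet> \<alpha> > 0}"
    using assms(2) unfolding positive_system_def by blast
  then interpret root_data R Rp \<xi> using assms(1) by unfold_locales
  let ?J = "simple_roots Rp - parabolic_simple_roots Rp Q"
  show ?thesis
  proof (rule mpoly_eqI)
    fix k :: "'a \<Rightarrow> int"
    let ?k = "k(\<beta> := - int j)"
    let ?v = "\<Sum>\<gamma>\<in>?J. of_int (?k \<gamma>) *\<^sub>R fundamental_weight Rp \<gamma>"
    have "(\<lambda>v. real_of_int (k v))(\<beta> := - real j) = (\<lambda>v. of_int (?k v))" by auto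
    then have "mpoly_eval (\<lambda>v. of_int (k v)) (mpoly_subst \<beta> (- real j) (hilbert_polynomial R Rp Q))
        = weyl_dim (?v + rho Rp)"
      by (simp only: mpoly_eval_subst hilbert_polynomial_eval)
    also have "\<dots> = 0"
    proof (rule weyl_dim_vanishes[OF assms(4-6)])
      show "?v \<bullet> coroot \<gamma> = 0" if "\<gamma> \<in> parabolic_simple_roots Rp Q" for \<gamma>
      proof -
        have "\<gamma> \<in> simple_roots Rp" using that by (simp add: parabolic_simple_roots_def)
        then show ?thesis
          using weight_coroot[OF Diff_subset, of \<gamma> "\<lambda>\<gamma>. of_int (?k \<gamma>)"] that by simp
      qed
      show "?v \<bullet> coroot \<beta> = - real j"
        using weight_coroot[OF Diff_subset, of \<beta> "\<lambda>\<gamma>. of_int (?k \<gamma>)"] assms(4) by simp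
    qed
    finally show "mpoly_eval (\<lambda>v. of_int (k v)) (mpoly_subst \<beta> (- real j) (hilbert_polynomial R Rp Q))
        = mpoly_eval (\<lambda>v. of_int (k v)) 0" by simp
  qed
qed

end
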